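(* Let $(\Omega,d)$ be a compact metric space of diameter $1$, let $T:\Omega\to\Omega$ be topologically mixing and let $a:\Omega\to\mathbb{R}$ satisfy $\mathcal{L}_a(\mathbf{1})=\mathbf{1}$. Assume that $(T,a)$ satisfies either Case 1 or Case 2 (defined in the context), with the associated $\gamma$, $\omega^\dagger$ and $\omega_n$. (1) If $\gamma>0$, then there exist a Borel probability measure $\mu$ on $\Omega$ and $C>0$ such that for every $\omega^\dagger$-Hölder continuous function $f:\Omega\to\mathbb{R}$ and every $n\in\mathbb{N}$, $$\|\mathcal{L}_a^n(f)-\mu(f)\|_\infty\le C\,\mathrm{H\ddot{o}l}_{\omega^\dagger}(f)\,n^{-\gamma}.$$ (2) If $\gamma>1$, then there exist a Borel probability measure $\mu$ on $\Omega$ and $C>0$ such that for every $\omega^\dagger$-Hölder continuous function $f:\Omega\to\mathbb{R}$ and every $n\in\mathbb{N}$, $$\|\mathcal{L}_a^n(f)-\mu(f)\|_{\omega_n}\le C\,\mathrm{H\ddot{o}l}_{\omega^\dagger}(f).$$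
   Context: $\mathbb{N}=\{1,2,\dots\}$; $\mu(f)=\int f\,d\mu$. Ruelle expansive: let $r>0$ and let $c_n:[0,1]\to[0,\infty)$ be functions with $c_n(0)=0$, $t\mapsto c_n(t)$ strictly increasing, $n\mapsto c_n(t)$ decreasing and $\lim_n c_n(t)=0$ for all $t$. $T$ is $(c,r)$-Ruelle expansive (contraction rate $c_n$) if for all $n\in\mathbb{N}$ and $x,y,\tilde x\in\Omega$ with $d(x,y)<r$ and $T^n(\tilde x)=x$ there is a unique $\tilde y\in\Omega$ with $T^n(\tilde y)=y$ and $d(T^k\tilde x,T^k\tilde y)\le c_{n-k}(d(x,y))$ for $k=0,\dots,n$. Ruelle expanding: there are $\lambda\in(0,1)$, $r>0$ such that for all $x,y,\tilde x$ with $d(x,y)<r$, $T(\tilde x)=x$ there is a unique $\tilde y$ with $T(\tilde y)=y$ and $d(\tilde x,\tilde y)<\lambda r$, and furthermore $d(\tilde x,\tilde y)\le\lambda d(x,y)$ (then $T$ is Ruelle expansive with $c_n(t)=\lambda^n t$). Throughout, $T$ and its iterates are local homeomorphisms of $\Omega$ (so preimage sets of points are finite). Topologically mixing: for all nonempty open $U,V\subset\Omega$ there is $k$ with $T^{-n}(U)\cap V\ne\emptyset$ for all $n>k$. Ruelle operator: $\mathcal{L}_a(f)(x)=\sum_{T(y)=x}e^{a(y)}f(y)$. Hölder classes: for a function $\omega:[0,1]\to[0,\infty)$, increasing with $\omega(0)=0$, $f$ is $\omega$-Hölder if there is a constant with $|f(x)-f(y)|\le \mathrm{H\ddot{o}l}_\omega(f)\,\omega(d(x,y))$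 for all $x,y\in\Omega$; $\mathrm{H\ddot{o}l}_\omega(f)$ is the least such constant, and $\|f\|_\omega=\|f\|_\infty+\mathrm{H\ddot{o}l}_\omega(f)$. For $\alpha,\beta\ge0$ (not both zero), $\omega_{\alpha,\beta\log}(t)=t^\alpha(\log t_0-\log t)^{-\beta}$, where $t_0>1$ is a constant chosen such that this function is concave on $[0,1]$; in particular $\omega_{\alpha,0\log}(t)=t^\alpha$. Case 1: $T$ is Ruelle expanding and $a$ is $\omega_{0,\beta\log}$-Hölder for some $\beta>1$. Then $\gamma:=\beta-1$, $\omega^\dagger:=\omega_{0,(\beta-1)\log}$ and $\omega_n(t):=(|\log t|+n)^{-\gamma}$ for $t\in(0,1]$, $\omega_n(0)=0$. Case 2: $T$ is Ruelle expansive with contraction rate $c_n(t)=(t^{-1/\beta}+n)^{-\beta}$ (up to a multiplicative constant) for some $\beta>1$ and $a$ is $\omega_{\alpha,0\log}$-Hölder for some $\alpha>1/\beta$. Then $\gamma:=\alpha\beta-1$, $\omega^\dagger:=\omega_{\alpha-1/\beta,0\log}$ and $\omega_n(t):=(t^{-1/\beta}+n)^{-\gamma}$ for $t\in(0,1]$, $\omega_n(0)=0$. *)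

theory Defs
  imports "HOL-Probability.Probability"
begin

definition local_homeomorphism :: "('a::topological_space \<Rightarrow> 'b::topological_space) \<Rightarrow> bool" where
  "local_homeomorphism f \<longleftrightarrow>
     (\<forall>x. \<exists>U. open U \<and> x \<in> U \<and> open (f ` U) \<and> (\<exists>g. homeomorphism U (f ` U) f g))"

definition topologically_mixing :: "('a::topological_space \<Rightarrow> 'a) \<Rightarrow> bool" where
  "topologically_mixing T \<longleftrightarrow>
     (\<forall>U V. open U \<longrightarrow> U \<noteq> {} \<longrightarrow> open V \<longrightarrow> V \<noteq> {} \<longrightarrow>
        (\<exists>k. \<forall>n>k. ((T ^^ n) -` U) \<inter> V \<noteq> {}))"

definition ruelle_expansive ::
    "(nat \<Rightarrow> real \<Rightarrow> real) \<Rightarrow> real \<Rightarrow> ('a::metric_space \<Rightarrow> 'a) \<Rightarrow> bool" where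
  "ruelle_expansive c r T \<longleftrightarrow>
     r > 0 \<and>
     (\<forall>n. c n 0 = 0 \<and> strict_mono_on {0..1} (c n)) \<and>
     (\<forall>t\<in>{0..1}. antimono (\<lambda>n. c n t) \<and> (\<lambda>n. c n t) \<longlonglongrightarrow> 0) \<and>
     (\<forall>n\<ge>1. \<forall>x y x'. dist x y < r \<longrightarrow> (T ^^ n) x' = x \<longrightarrow>
        (\<exists>!y'. (T ^^ n) y' = y \<and>
           (\<forall>k\<le>n. dist ((T ^^ k) x') ((T ^^ k) y') \<le> c (n - k) (dist x y))))"

definition ruelle_expanding :: "('a::metric_space \<Rightarrow> 'a) \<Rightarrow> bool" where
  "ruelle_expanding T \<longleftrightarrow>
     (\<exists>l r. 0 < l \<and> l < 1 \<and> r > 0 \<and>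
        (\<forall>x y x'. dist x y < r \<longrightarrow> T x' = x \<longrightarrow>
           (\<exists>!y'. T y' = y \<and> dist x' y' < l * r) \<and>
           (\<forall>y'. T y' = y \<and> dist x' y' < l * r \<longrightarrow> dist x' y' \<le> l * dist x y)))"

text \<open>The fibres of a local homeomorphism of a compact metric space are finite, so the sum below
  is a genuine finite sum wherever the operator is used.\<close>

definition ruelle_operator :: "('a \<Rightarrow> 'a) \<Rightarrow> ('a \<Rightarrow> real) \<Rightarrow> ('a \<Rightarrow> real) \<Rightarrow> 'a \<Rightarrow> real" where
  "ruelle_operator T a f x = (\<Sum>y\<in>{y. T y = x}. exp (a y) * f y)"

definition holder_bound :: "(real \<Rightarrow> real) \<Rightarrow> ('a::metric_space \<Rightarrow> real) \<Rightarrow> real \<Rightarrow> bool" where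
  "holder_bound \<omega> f C \<longleftrightarrow> C \<ge> 0 \<and> (\<forall>x y. \<bar>f x - f y\<bar> \<le> C * \<omega> (dist x y))"

definition is_holder :: "(real \<Rightarrow> real) \<Rightarrow> ('a::metric_space \<Rightarrow> real) \<Rightarrow> bool" where
  "is_holder \<omega> f \<longleftrightarrow> (\<exists>C. holder_bound \<omega> f C)"

text \<open>The next three quantities are real-valued, hence meaningful only when finite:
  \<open>holder_const \<omega> f\<close> for \<open>is_holder \<omega> f\<close>, and \<open>sup_norm f\<close> for bounded \<open>f\<close>.
  A bound on an extended norm is therefore to be stated together with its finiteness.\<close>

definition holder_const :: "(real \<Rightarrow> real) \<Rightarrow> ('a::metric_space \<Rightarrow> real) \<Rightarrow> real" where
  "holder_const \<omega> f = Inf {C. holder_bound \<omega> f C}"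

definition sup_norm :: "('a \<Rightarrow> real) \<Rightarrow> real" where
  "sup_norm f = (SUP x. \<bar>f x\<bar>)"

definition holder_norm :: "(real \<Rightarrow> real) \<Rightarrow> ('a::metric_space \<Rightarrow> real) \<Rightarrow> real" where
  "holder_norm \<omega> f = sup_norm f + holder_const \<omega> f"

text \<open>The value at \<open>0\<close> is prescribed separately here and in the rates below, since \<open>ln 0 = 0\<close>
  and \<open>0 powr s = 0\<close> are not the intended limits.\<close>

definition omega_log :: "real \<Rightarrow> real \<Rightarrow> real \<Rightarrow> real \<Rightarrow> real" where
  "omega_log t0 \<alpha> \<beta> t =
     (if t = 0 then 0 else t powr \<alpha> * (ln t0 - ln t) powr (- \<beta>))"

definition admissible_t0 :: "real \<Rightarrow> real \<Rightarrow> real \<Rightarrow> bool" where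
  "admissible_t0 \<alpha> \<beta> t0 \<longleftrightarrow> t0 > 1 \<and> concave_on {0..1} (omega_log t0 \<alpha> \<beta>)"

text \<open>\<open>case_one T a \<gamma> \<omega>d \<omega>\<close> and \<open>case_two T a \<gamma> \<omega>d \<omega>\<close> say that \<open>(T, a)\<close> is of the respective type with
  associated exponent \<open>\<gamma>\<close>, modulus \<open>\<omega>\<^sup>\<dagger> = \<omega>d\<close> and moduli \<open>\<omega>\<^sub>n = \<omega> n\<close>.
  The constant \<open>t0\<close> may be chosen separately for each pair of exponents.\<close>

definition case_one ::
    "('a::metric_space \<Rightarrow> 'a) \<Rightarrow> ('a \<Rightarrow> real) \<Rightarrow> real \<Rightarrow> (real \<Rightarrow> real) \<Rightarrow> (nat \<Rightarrow> real \<Rightarrow> real) \<Rightarrow> bool" where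
  "case_one T a \<gamma> \<omega>d \<omega> \<longleftrightarrow>
     (\<exists>\<beta> t0 t1. \<beta> > 1 \<and> admissible_t0 0 \<beta> t0 \<and> admissible_t0 0 (\<beta> - 1) t1 \<and>
        ruelle_expanding T \<and>
        is_holder (omega_log t0 0 \<beta>) a \<and>
        \<gamma> = \<beta> - 1 \<and>
        \<omega>d = omega_log t1 0 (\<beta> - 1) \<and>
        \<omega> = (\<lambda>n t. if t = 0 then 0 else (\<bar>ln t\<bar> + real n) powr (- \<gamma>)))"

definition poly_rate :: "real \<Rightarrow> real \<Rightarrow> nat \<Rightarrow> real \<Rightarrow> real" where
  "poly_rate K \<beta> n t = (if t = 0 then 0 else K * (t powr (- 1 / \<beta>) + real n) powr (- \<beta>))"

text \<open>For a vanishing logarithmic exponent, \<open>omega_log t0 \<alpha> 0 t = t powr \<alpha>\<close> on \<open>[0,1]\<close> for every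
  \<open>t0 > 1\<close>; the choice of \<open>t0\<close> is immaterial below, and \<open>\<alpha> > 1\<close> is not excluded.\<close>

definition case_two ::
    "('a::metric_space \<Rightarrow> 'a) \<Rightarrow> ('a \<Rightarrow> real) \<Rightarrow> real \<Rightarrow> (real \<Rightarrow> real) \<Rightarrow> (nat \<Rightarrow> real \<Rightarrow> real) \<Rightarrow> bool" where
  "case_two T a \<gamma> \<omega>d \<omega> \<longleftrightarrow>
     (\<exists>\<alpha> \<beta> K r t0. \<beta> > 1 \<and> \<alpha> > 1 / \<beta> \<and> K > 0 \<and> t0 > 1 \<and>
        ruelle_expansive (poly_rate K \<beta>) r T \<and>
        is_holder (omega_log t0 \<alpha> 0) a \<and>
        \<gamma> = \<alpha> * \<beta> - 1 \<and>
        \<omega>d = omega_log t0 (\<alpha> - 1 / \<beta>) 0 \<and>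
        \<omega> = (\<lambda>n t. if t = 0 then 0 else (t powr (- 1 / \<beta>) + real n) powr (- \<gamma>)))"

end

theory Submission
  imports Defs
begin

text \<open>The key point is that the inverse orbits of two close points \<open>x\<close>, \<open>y\<close> can be matched: with
  \<open>\<sigma> = 1 - ln (d x y)\<close> in Case 1 and \<open>\<sigma> = (d x y) powr (- 1 / \<beta>)\<close> in Case 2, the potential differs
  by \<open>O((\<sigma> + k) powr (- \<gamma> - 1))\<close> along the matched orbits after \<open>k\<close> steps, and a \<open>\<omega>\<^sup>\<dagger>\<close>-Hoelder function
  by \<open>O((\<sigma> + k) powr (- \<gamma>))\<close>. Telescoping bounds the difference of the iterates at \<open>x\<close>, \<open>y\<close> by
  the oscillations of the earlier iterates, with weights \<open>(\<sigma> + k) powr (- \<gamma> - 1)\<close>, whose sum is as small as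
  desired for close points. Together with mixing this yields a defective renewal inequality
  for the oscillations, whose solutions decay like \<open>n powr (- \<gamma>)\<close>. The limit functional is
  represented by a measure, obtained as a weak limit of the distributions of random inverse orbits.
  The Hoelder bound in (2) interpolates between this decay and a uniform \<open>\<omega>\<^sup>\<dagger>\<close>-Hoelder bound on
  the iterates.\<close>

section \<open>Weak limits of discrete distributions on a compact metric space\<close>

text \<open>One power is lost between the potential, with exponent \<gamma> + 1, and the functions,
  with exponent \<gamma>. This is the price of summation: the weights
  \<open>(\<sigma> + k) powr (- \<gamma> - 1)\<close> add up to at most
  \<open>\<sigma> powr (- \<gamma>) / \<gamma>\<close>. A matched pair of random inverse orbits can
  separate at any later depth k, with probability of the order of the k-th weight, and after that
  only the oscillation of an earlier iterate bounds the difference; this is where the convolution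
  comes from.

  In Case 2 the partner of a preimage is unique only relative to a whole orbit segment, not to a
  single step. Matching is therefore expressed by a relation indexed by depth, which may record the
  past, and not by a bound on distances.

  The measure comes from Helly's theorem through a code of points by reals. A code with ternary
  digits 0 and 1 has values in a Cantor set, so on a connected space it is continuous only if it is
  constant. Hence only the inverse direction can be used, and the limit law has to be decoded on the
  closure of the codes.\<close>

text \<open>At the first index \<open>i\<close> where the digits differ, the leading term is
  \<open>(1 / 3) ^ i\<close>, while the whole tail is at most half of it. Base 2 would let the tail
  cancel the leading term.\<close>

lemma ternary_series_gap:
  fixes b c :: "nat \<Rightarrow> bool"
  defines "v \<equiv> \<lambda>b :: nat \<Rightarrow> bool. \<Sum>i. of_bool (b i) * (1 / 3 :: real) ^ i"
  assumes "b j \<noteq> c j"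
  shows "\<exists>i\<le>j. \<bar>v b - v c\<bar> \<ge> (1 / 3) ^ i / 2"
proof -
  define i where "i = (LEAST i. b i \<noteq> c i)"
  have i: "b i \<noteq> c i" "i \<le> j" "\<And>k. k < i \<Longrightarrow> b k = c k"
    unfolding i_def using assms(2)
    by (rule LeastI, rule Least_le) (use not_less_Least in blast)
  define e where "e = (\<lambda>i. of_bool (b i) - of_bool (c i) :: real)"
  have sm: "summable (\<lambda>i. of_bool (b i) * (1 / 3 :: real) ^ i)" for b
    by (rule summable_comparison_test'[OF summable_geometric[of "1/3 :: real"], of 0]) auto
  have sme: "summable (\<lambda>i. e i * (1 / 3) ^ i)"
    using summable_diff[OF sm[of b] sm[of c]] by (simp add: e_def algebra_simps)
  have "v b - v c = (\<Sum>i. e i * (1 / 3) ^ i)"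
    unfolding v_def suminf_diff[OF sm sm] by (simp add: e_def algebra_simps)
  also have "\<dots> = (\<Sum>k. e (k + Suc i) * (1 / 3) ^ (k + Suc i)) + (\<Sum>k<Suc i. e k * (1 / 3) ^ k)"
    by (rule suminf_split_initial_segment[OF sme])
  also have "(\<Sum>k<Suc i. e k * (1 / 3) ^ k) = e i * (1 / 3) ^ i"
    using i by (simp add: e_def)
  finally have eq: "v b - v c = (\<Sum>k. e (k + Suc i) * (1 / 3) ^ (k + Suc i)) + e i * (1 / 3) ^ i" .
  have g: "(\<lambda>k. (1 / 3 :: real) ^ (k + Suc i)) sums ((1 / 3) ^ i / 2)"
    using sums_mult2[OF geometric_sums[of "1/3 :: real"], of "(1/3) ^ Suc i"]
    by (simp add: power_add algebra_simps)
  have "\<bar>\<Sum>k. e (k + Suc i) * (1 / 3) ^ (k + Suc i)\<bar> \<le> (\<Sum>k. (1 / 3 :: real) ^ (k + Suc i))"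
    unfolding real_norm_def[symmetric]
    by (rule norm_suminf_le[OF _ sums_summable[OF g]]) (auto simp: e_def abs_mult power_abs)
  also have "\<dots> = (1 / 3) ^ i / 2"
    using g by (rule sums_unique[symmetric])
  finally have "\<bar>\<Sum>k. e (k + Suc i) * (1 / 3) ^ (k + Suc i)\<bar> \<le> (1 / 3) ^ i / 2" .
  moreover have "\<bar>e i * (1 / 3) ^ i\<bar> = (1 / 3) ^ i"
    using i by (cases "b i"; cases "c i") (auto simp: e_def)
  ultimately have "\<bar>v b - v c\<bar> \<ge> (1 / 3) ^ i / 2"
    unfolding eq by linarith
  with i(2) show ?thesis by blast
qed

text \<open>The digits of \<open>g x\<close> record which balls, taken from finite nets of every
  scale \<open>1 / Suc k\<close>, contain \<open>x\<close>. Close codes agree on all balls of one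
  net, and any two points in a common ball of that net are close.\<close>

lemma compact_metric_real_code:
  assumes "compact (UNIV :: 'a::metric_space set)"
  shows "\<exists>g :: 'a::metric_space \<Rightarrow> real. range g \<subseteq> {0..3/2} \<and>
    (\<forall>e>0. \<exists>\<delta>>0. \<forall>x y. \<bar>g x - g y\<bar> < \<delta> \<longrightarrow> dist x y < e)"
proof -
  have "\<exists>K :: 'a set. finite K \<and> UNIV = (\<Union>x\<in>K. ball x (1 / Suc k))" for k
  proof -
    obtain K :: "'a set" where "finite K" "UNIV \<subseteq> (\<Union>x\<in>K. ball x (1 / Suc k))"
    proof (rule compactE_image[OF assms, of UNIV "\<lambda>x. ball x (1 / Suc k)"])
      show "(UNIV :: 'a set) \<subseteq> (\<Union>x\<in>UNIV. ball x (1 / Suc k))"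
      proof
        fix x :: 'a
        have "x \<in> ball x (1 / Suc k)" by simp
        then show "x \<in> (\<Union>x\<in>UNIV. ball x (1 / Suc k))" by blast
      qed
    qed auto
    then show ?thesis by (intro exI[of _ K] conjI) auto
  qed
  then obtain K :: "nat \<Rightarrow> 'a set"
    where K: "\<And>k. finite (K k)" "\<And>k. UNIV = (\<Union>x\<in>K k. ball x (1 / Suc k))"
    by metis
  define S where "S = (\<Union>k. (\<lambda>x. ball x (1 / Suc k)) ` K k)"
  have "K 0 \<noteq> {}" using K(2)[of 0] by auto
  then have S: "countable S" "S \<noteq> {}"
    using K(1) by (auto simp: S_def countable_finite)
  define A where "A = from_nat_into S"
  have A: "\<exists>i. A i = X" if "X \<in> S" for X
    using from_nat_into_surj[OF S(1) that] by (simp add: A_def)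
  define g where "g x = (\<Sum>i. of_bool (x \<in> A i) * (1 / 3 :: real) ^ i)" for x
  have sm: "summable (\<lambda>i. of_bool (x \<in> A i) * (1 / 3 :: real) ^ i)" for x
    by (rule summable_comparison_test'[OF summable_geometric[of "1/3 :: real"], of 0]) auto
  show ?thesis
  proof (intro exI[of _ g] conjI allI impI)
    have "g x \<le> 3 / 2" for x
    proof -
      have "g x \<le> (\<Sum>i. (1 / 3 :: real) ^ i)"
        unfolding g_def by (rule suminf_le[OF _ sm]) auto
      then show ?thesis by (simp add: suminf_geometric)
    qed
    moreover have "g x \<ge> 0" for x
      unfolding g_def by (rule suminf_nonneg[OF sm]) auto
    ultimately show "range g \<subseteq> {0..3/2}" by auto
  next
    fix e :: real assume "e > 0"
    obtain k :: nat where "2 / e < real k"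
      using reals_Archimedean2 by blast
    then have k: "2 / e < Suc k" by simp
    have k': "1 / Suc k + 1 / Suc k < e"
      using k \<open>e > 0\<close> by (simp add: field_simps)
    have "\<forall>x\<in>K k. \<exists>i. A i = ball x (1 / Suc k)"
      by (intro ballI A) (auto simp: S_def)
    then obtain idx where idx: "\<And>x. x \<in> K k \<Longrightarrow> A (idx x) = ball x (1 / Suc k)"
      by metis
    define m where "m = Max (idx ` K k)"
    have m: "idx x \<le> m" if "x \<in> K k" for x
      using that K(1) by (simp add: m_def)
    show "\<exists>\<delta>>0. \<forall>x y. \<bar>g x - g y\<bar> < \<delta> \<longrightarrow> dist x y < e"
    proof (intro exI conjI allI impI)
      \<comment> \<open>\<open>m\<close> dominates the indices of all balls of the k-th net, so
        codes closer than this cannot differ on any of them.\<close>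
      show "(1 / 3) ^ m / 2 > (0 :: real)" by simp
      fix x y assume less: "\<bar>g x - g y\<bar> < (1 / 3) ^ m / 2"
      obtain z where z: "z \<in> K k" "x \<in> ball z (1 / Suc k)"
        using K(2)[of k] by blast
      have "y \<in> ball z (1 / Suc k)"
      proof (rule ccontr)
        assume "y \<notin> ball z (1 / Suc k)"
        then have "(x \<in> A (idx z)) \<noteq> (y \<in> A (idx z))"
          using z idx by simp
        from ternary_series_gap[of "\<lambda>i. x \<in> A i" "idx z" "\<lambda>i. y \<in> A i", OF this]
        obtain i where i: "i \<le> idx z" "\<bar>g x - g y\<bar> \<ge> (1 / 3) ^ i / 2"
          unfolding g_def by blast
        have "(1 / 3 :: real) ^ m \<le> (1 / 3) ^ i"
          using i(1) m[OF z(1)] by (intro power_decreasing) auto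
        with i(2) less show False by linarith
      qed
      then show "dist x y < e"
        using z(2) k' dist_triangle3[of x y z] by simp
    qed
  qed
qed

text \<open>Helly's selection theorem is transported from the real line along an injective code whose
  inverse is uniformly continuous, so that it extends to the closure of the set of codes.\<close>

lemma pmf_weak_subsequence:
  fixes p :: "nat \<Rightarrow> 'a::metric_space pmf"
  assumes cpt: "compact (UNIV :: 'a set)"
  shows "\<exists>(\<mu> :: 'a measure) s. prob_space \<mu> \<and> sets \<mu> = sets borel \<and> strict_mono (s :: nat \<Rightarrow> nat) \<and>
           (\<forall>f :: 'a \<Rightarrow> real. continuous_on UNIV f \<longrightarrow>
              (\<lambda>n. measure_pmf.expectation (p (s n)) f) \<longlonglongrightarrow> integral\<^sup>L \<mu> f)"
proof -
  obtain g :: "'a \<Rightarrow> real" where g_range: "range g \<subseteq> {0..3/2}"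
    and g_inv: "\<And>e. e > 0 \<Longrightarrow> \<exists>\<delta>>0. \<forall>x y. \<bar>g x - g y\<bar> < \<delta> \<longrightarrow> dist x y < e"
    using compact_metric_real_code[OF cpt] by blast
  define \<nu> where "\<nu> n = distr (measure_pmf (p n)) borel g" for n
  have \<nu>_dist: "real_distribution (\<nu> n)" for n
    unfolding \<nu>_def by (rule prob_space.real_distribution_distr[OF prob_space_measure_pmf]) simp
  have \<nu>_int: "integral\<^sup>L (\<nu> n) F = measure_pmf.expectation (p n) (\<lambda>x. F (g x))"
    if "continuous_on UNIV F" for n and F :: "real \<Rightarrow> real"
    unfolding \<nu>_def using that by (intro integral_distr borel_measurable_continuous_onI) auto
  have "tight \<nu>"
    unfolding tight_def
  proof (intro conjI allI impI \<nu>_dist)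
    fix e :: real assume "e > 0"
    have "measure (\<nu> n) {-1<..2} = 1" for n
    proof -
      have "g -` {-1<..2} = UNIV" using g_range by (force simp: subset_iff)
      then show ?thesis
        by (simp add: \<nu>_def measure_distr)
    qed
    with \<open>e > 0\<close> show "\<exists>a b. a < b \<and> (\<forall>n. measure (\<nu> n) {a<..b} > 1 - e)"
      by (intro exI[of _ "-1"] exI[of _ 2]) auto
  qed
  from tight_imp_convergent_subsubsequence[OF this strict_mono_id]
  obtain s N where s: "strict_mono (s :: nat \<Rightarrow> nat)" and N: "real_distribution N"
    and conv: "weak_conv_m (\<lambda>n. \<nu> (s n)) N"
    by (auto simp: comp_def)
  interpret N: real_distribution N by fact
  have lim: "(\<lambda>n. measure_pmf.expectation (p (s n)) (\<lambda>x. F (g x))) \<longlonglongrightarrow> integral\<^sup>L N F"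
    if "continuous_on UNIV F" "\<And>x. \<bar>F x\<bar> \<le> B" for F :: "real \<Rightarrow> real" and B
    using weak_conv_imp_integral_bdd_continuous_conv[of "\<lambda>n. \<nu> (s n)" N F B] \<nu>_dist N conv that
    by (simp add: continuous_on_eq_continuous_at \<nu>_int)

  \<comment> \<open>The codes need not form a closed set, and the limit law \<open>N\<close> may
    charge limits of codes. The decoding \<open>h\<close> is defined there by compactness: points
    whose codes converge have a convergent subsequence.\<close>
  define C where "C = closure (range g)"
  have C: "closed C" "C \<noteq> {}" by (auto simp: C_def)
  have "\<exists>x u. u \<longlonglongrightarrow> x \<and> (\<lambda>n. g (u n)) \<longlonglongrightarrow> t" if "t \<in> C" for t
  proof -
    from that obtain v where v: "\<forall>n. v n \<in> range g" "v \<longlonglongrightarrow> t"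
      unfolding C_def closure_sequential by (elim exE conjE)
    from v(1) have "\<forall>n. \<exists>x. v n = g x" by auto
    from choice[OF this] obtain u where u: "\<And>n. v n = g (u n)" by auto
    from cpt[unfolded compact_def, rule_format, of u]
    obtain x q where "strict_mono (q :: nat \<Rightarrow> nat)" "(u \<circ> q) \<longlonglongrightarrow> x"
      by auto
    with v(2) u show ?thesis
      using LIMSEQ_subseq_LIMSEQ[of v t q] by (auto simp: comp_def)
  qed
  then have "\<forall>t. \<exists>xu. t \<in> C \<longrightarrow> snd xu \<longlonglongrightarrow> fst xu \<and> (\<lambda>n. g (snd xu n)) \<longlonglongrightarrow> t"
    by fastforce
  from choice[OF this] obtain hu
    where hu': "\<And>t. t \<in> C \<Longrightarrow> snd (hu t) \<longlonglongrightarrow> fst (hu t) \<and> (\<lambda>n. g (snd (hu t) n)) \<longlonglongrightarrow> t"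
    by blast
  define h where "h t = fst (hu t)" for t
  define u where "u t = snd (hu t)" for t
  have hu: "u t \<longlonglongrightarrow> h t" "(\<lambda>n. g (u t n)) \<longlonglongrightarrow> t" if "t \<in> C" for t
    using hu'[OF that] by (simp_all add: h_def u_def)
  have h_unif: "\<exists>\<delta>>0. \<forall>t\<in>C. \<forall>t'\<in>C. \<bar>t - t'\<bar> < \<delta> \<longrightarrow> dist (h t) (h t') \<le> e" if e: "e > 0" for e
  proof -
    obtain \<delta> where \<delta>: "\<delta> > 0" "\<And>x y. \<bar>g x - g y\<bar> < \<delta> \<Longrightarrow> dist x y < e"
      using g_inv[OF e] by blast
    have "dist (h t) (h t') \<le> e" if t: "t \<in> C" "t' \<in> C" "\<bar>t - t'\<bar> < \<delta>" for t t'
    proof (rule tendsto_upperbound)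
      show "(\<lambda>n. dist (u t n) (u t' n)) \<longlonglongrightarrow> dist (h t) (h t')"
        by (intro tendsto_dist hu t)
      have "(\<lambda>n. \<bar>g (u t n) - g (u t' n)\<bar>) \<longlonglongrightarrow> \<bar>t - t'\<bar>"
        by (intro tendsto_intros hu t)
      from order_tendstoD(2)[OF this t(3)]
      show "\<forall>\<^sub>F n in sequentially. dist (u t n) (u t' n) \<le> e"
        by eventually_elim (use \<delta>(2) in \<open>auto intro: less_imp_le\<close>)
    qed simp
    with \<delta>(1) show ?thesis by blast
  qed
  have h_cont: "continuous_on C h"
    unfolding continuous_on_iff
  proof (intro ballI allI impI)
    fix t and e :: real assume "t \<in> C" "e > 0"
    have "e / 2 > 0" using \<open>e > 0\<close> by simp
    from h_unif[OF this] obtain \<delta>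
      where \<delta>: "\<delta> > 0" "\<And>t t'. t \<in> C \<Longrightarrow> t' \<in> C \<Longrightarrow> \<bar>t - t'\<bar> < \<delta> \<Longrightarrow> dist (h t) (h t') \<le> e / 2"
      by blast
    have "dist (h x') (h t) < e" if "x' \<in> C" "dist x' t < \<delta>" for x'
      using \<delta>(2)[OF that(1) \<open>t \<in> C\<close>] that(2) \<open>e > 0\<close> by (simp add: dist_real_def)
    with \<delta>(1) show "\<exists>d>0. \<forall>x'\<in>C. dist x' t < d \<longrightarrow> dist (h x') (h t) < e"
      by blast
  qed
  have gC: "g x \<in> C" for x
    unfolding C_def by (rule subsetD[OF closure_subset]) simp
  have hg: "h (g x) = x" for x
  proof (rule LIMSEQ_unique[OF hu(1)[OF gC]])
    show "u (g x) \<longlonglongrightarrow> x"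
    proof (rule tendstoI)
      fix e :: real assume "e > 0"
      obtain \<delta> where \<delta>: "\<delta> > 0" "\<And>x y. \<bar>g x - g y\<bar> < \<delta> \<Longrightarrow> dist x y < e"
        using g_inv[OF \<open>e > 0\<close>] by blast
      have "\<forall>\<^sub>F n in sequentially. dist (g (u (g x) n)) (g x) < \<delta>"
        using hu(2)[OF gC] \<delta>(1) by (rule tendstoD)
      then show "\<forall>\<^sub>F n in sequentially. dist (u (g x) n) x < e"
        by eventually_elim (use \<delta>(2) in \<open>auto simp: dist_real_def\<close>)
    qed
  qed
  \<comment> \<open>A constant value off the closed set \<open>C\<close> makes the decoding Borel on
    the whole line; \<open>C\<close> turns out to have full measure.\<close>
  define h' where "h' t = (if t \<in> C then h t else undefined)" for t
  have h'_meas: "h' \<in> borel_measurable borel"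
    unfolding h'_def[abs_def]
    by (rule borel_measurable_continuous_on_if) (use C h_cont in auto)
  have AE_C: "AE t in N. t \<in> C"
  proof -
    \<comment> \<open>A bounded continuous test function with zero set \<open>C\<close>. It vanishes
      at every code, so its integral against the weak limit is 0.\<close>
    let ?\<phi> = "\<lambda>t. min 1 (infdist t C)"
    have \<phi>: "continuous_on UNIV ?\<phi>" "\<And>t. \<bar>?\<phi> t\<bar> \<le> 1"
      by (auto intro!: continuous_intros simp: infdist_nonneg)
    have "(\<lambda>n. measure_pmf.expectation (p (s n)) (\<lambda>x. ?\<phi> (g x))) \<longlonglongrightarrow> integral\<^sup>L N ?\<phi>"
      by (rule lim[OF \<phi>])
    then have "integral\<^sup>L N ?\<phi> = 0"
      using gC by (simp add: LIMSEQ_const_iff)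
    moreover have "integrable N ?\<phi>"
      by (rule N.integrable_const_bound[of _ 1])
         (use \<phi> in \<open>auto intro!: borel_measurable_continuous_onI simp: measurable_cong_sets[OF N.events_eq_borel refl]\<close>)
    ultimately have "AE t in N. ?\<phi> t = 0"
      by (subst integral_nonneg_eq_0_iff_AE[symmetric]) (auto simp: infdist_nonneg)
    then show ?thesis
      by eventually_elim (use C in \<open>auto simp: in_closed_iff_infdist_zero min_def split: if_splits\<close>)
  qed
  define \<mu> where "\<mu> = distr N borel h'"
  have "(\<lambda>n. measure_pmf.expectation (p (s n)) f) \<longlonglongrightarrow> integral\<^sup>L \<mu> f"
    if f: "continuous_on UNIV f" for f :: "'a \<Rightarrow> real"
  proof -
    have "bounded (range f)"
      using compact_continuous_image[OF f cpt] by (rule compact_imp_bounded)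
    then obtain B where B: "\<And>x. \<bar>f x\<bar> \<le> B" 
      unfolding bounded_iff by auto
    have B0: "0 \<le> B" using B[of undefined] by linarith
    have "continuous_on C (\<lambda>t. f (h t))"
      by (rule continuous_on_compose2[OF f h_cont]) auto
    \<comment> \<open>Weak convergence needs a bounded continuous test function on the line, whereas
      \<open>f\<close> composed with \<open>h\<close> is continuous only on
      \<open>C\<close>.\<close>
    from Tietze[OF this _ B0, of UNIV] C B
    obtain F where F: "continuous_on UNIV F" "\<And>t. t \<in> C \<Longrightarrow> F t = f (h t)" "\<And>t. \<bar>F t\<bar> \<le> B"
      by auto
    have Fm: "F \<in> borel_measurable N"
      using borel_measurable_continuous_onI[OF F(1)] by (simp add: measurable_cong_sets[OF N.events_eq_borel refl])
    have h'm: "h' \<in> measurable N borel"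
      using h'_meas by (simp add: measurable_cong_sets[OF N.events_eq_borel refl])
    have fm: "f \<in> borel_measurable borel"
      by (rule borel_measurable_continuous_onI[OF f])
    have "integral\<^sup>L \<mu> f = (\<integral>t. f (h' t) \<partial>N)"
      unfolding \<mu>_def by (rule integral_distr[OF h'm fm])
    also have "\<dots> = integral\<^sup>L N F"
      using AE_C measurable_compose[OF h'm fm] Fm
      by (intro integral_cong_AE) (auto elim!: eventually_mono simp: F(2) h'_def)
    finally have "integral\<^sup>L \<mu> f = integral\<^sup>L N F" .
    with lim[OF F(1,3)] show ?thesis
      by (simp add: F(2)[OF gC] hg)
  qed
  moreover have "prob_space \<mu>"
    unfolding \<mu>_def using h'_meas
    by (intro N.prob_space_distr) (simp add: measurable_cong_sets[OF N.events_eq_borel refl])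
  ultimately show ?thesis
    using s by (intro exI[of _ \<mu>] exI[of _ s]) (auto simp: \<mu>_def)
qed

section \<open>A renewal inequality with polynomial weights\<close>

text \<open>Integral comparison in telescoped form: the mean value theorem bounds each term by a
  decrement of \<open>t powr (- \<gamma>) / \<gamma>\<close>.\<close>

lemma sum_shifted_powr_le:
  fixes s \<gamma> :: real
  assumes "s > 0" "\<gamma> > 0"
  shows "(\<Sum>k=1..n. (s + real k) powr (- \<gamma> - 1)) \<le> s powr (- \<gamma>) / \<gamma>"
proof -
  have step: "(t + 1) powr (- \<gamma> - 1) \<le> (t powr (- \<gamma>) - (t + 1) powr (- \<gamma>)) / \<gamma>" if "t > 0" for t :: real
  proof -
    have "\<exists>z>t. z < t + 1 \<and> (t + 1) powr (- \<gamma>) - t powr (- \<gamma>) = (t + 1 - t) * (- \<gamma> * z powr (- \<gamma> - 1))"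
      using that by (intro MVT2) (auto intro!: derivative_eq_intros)
    then obtain z where z: "t < z" "z < t + 1"
      "(t + 1) powr (- \<gamma>) - t powr (- \<gamma>) = - \<gamma> * z powr (- \<gamma> - 1)" by auto
    have "(t + 1) powr (- \<gamma> - 1) \<le> z powr (- \<gamma> - 1)"
      using z that assms by (intro powr_mono2') auto
    then have "\<gamma> * (t + 1) powr (- \<gamma> - 1) \<le> t powr (- \<gamma>) - (t + 1) powr (- \<gamma>)"
      using z(3) assms mult_left_mono[of "(t + 1) powr (- \<gamma> - 1)" "z powr (- \<gamma> - 1)" \<gamma>] by linarith
    with assms show ?thesis by (simp add: field_simps)
  qed
  have "(\<Sum>k=1..n. (s + real k) powr (- \<gamma> - 1)) \<le> (s powr (- \<gamma>) - (s + real n) powr (- \<gamma>)) / \<gamma>"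
  proof (induction n)
    case (Suc n)
    show ?case
      using Suc.IH step[of "s + real n"] assms by (simp add: add_ac diff_divide_distrib)
  qed simp
  also have "\<dots> \<le> s powr (- \<gamma>) / \<gamma>"
    using assms by (simp add: divide_right_mono)
  finally show ?thesis .
qed

text \<open>For \<gamma> \<le> 1 the sums of \<open>real (Suc n) powr (- \<gamma>)\<close> diverge;
  their means still vanish, and this is what the convolution estimate uses.\<close>

lemma cesaro_mean_null:
  fixes u :: "nat \<Rightarrow> real"
  assumes "u \<longlonglongrightarrow> 0"
  shows "(\<lambda>n. (\<Sum>j\<le>n. u j) / real (Suc n)) \<longlonglongrightarrow> 0"
proof (rule LIMSEQ_I)
  fix e :: real assume "e > 0"
  obtain J where J: "\<And>j. j \<ge> J \<Longrightarrow> \<bar>u j\<bar> < e / 2"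
    using LIMSEQ_D[OF assms, of "e / 2"] \<open>e > 0\<close> by auto
  define M where "M = (\<Sum>j<J. \<bar>u j\<bar>)"
  obtain K :: nat where K: "2 * M / e < real K"
    using reals_Archimedean2 by blast
  have "\<bar>(\<Sum>j\<le>n. u j) / real (Suc n)\<bar> < e" if "n \<ge> K" for n
  proof -
    have "\<bar>\<Sum>j\<le>n. u j\<bar> \<le> (\<Sum>j\<le>n. \<bar>u j\<bar>)" by (rule sum_abs)
    also have "\<dots> \<le> (\<Sum>j\<le>n. (if j < J then \<bar>u j\<bar> else 0) + e / 2)"
      using J \<open>e > 0\<close> by (intro sum_mono) (auto simp: not_less less_imp_le)
    also have "\<dots> = (\<Sum>j\<in>{..n} \<inter> {..<J}. \<bar>u j\<bar>) + real (Suc n) * (e / 2)"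
      by (simp add: sum.distrib sum.If_cases lessThan_def)
    also have "(\<Sum>j\<in>{..n} \<inter> {..<J}. \<bar>u j\<bar>) \<le> M"
      unfolding M_def by (intro sum_mono2) auto
    also have "M < real (Suc n) * (e / 2)"
      using K that \<open>e > 0\<close> by (simp add: field_simps) (smt (verit) mult_left_mono of_nat_mono)
    finally have "\<bar>\<Sum>j\<le>n. u j\<bar> < real (Suc n) * e" by (simp add: algebra_simps)
    then have "\<bar>\<Sum>j\<le>n. u j\<bar> < e * real (Suc n)" by (simp only: mult.commute)
    then show ?thesis
      by (simp only: abs_divide abs_of_nat pos_divide_less_eq of_nat_0_less_iff zero_less_Suc)
  qed
  then show "\<exists>no. \<forall>n\<ge>no. norm ((\<Sum>j\<le>n. u j) / real (Suc n) - 0) < e" by auto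
qed

text \<open>The sum is split at \<open>k = \<delta> * real (Suc n)\<close>. Below it,
  \<open>n - k\<close> is comparable to \<open>n\<close> and the second factor grows by at most 5/4;
  above it, the weight is at most a constant times
  \<open>real (Suc n) powr (- \<gamma> - 1)\<close>, which leaves a Cesaro mean. The total is 5/4 *
  1/2 + 1/8 = 3/4.\<close>

lemma convolution_powr_le:
  fixes s \<gamma> C :: real
  assumes "\<gamma> > 0" "s \<ge> 1" "C \<ge> 0" and C: "C * (s powr (- \<gamma>) / \<gamma>) \<le> 1 / 2"
  shows "\<forall>\<^sub>F n in sequentially.
    C * (\<Sum>k=1..n. (s + real k) powr (- \<gamma> - 1) * real (Suc (n - k)) powr (- \<gamma>))
      \<le> 3 / 4 * real (Suc n) powr (- \<gamma>)"
proof -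
  define u where "u n = real (Suc n) powr (- \<gamma>)" for n
  \<comment> \<open>Chosen so that shrinking the argument by the factor \<open>q\<close> raises the
    power \<open>- \<gamma>\<close> by exactly 5/4; \<open>k \<le> \<delta> * real (Suc n)\<close>
    means that \<open>Suc (n - k)\<close> is at least \<open>q * real (Suc n)\<close>.\<close>
  define q where "q = (5 / 4 :: real) powr (- 1 / \<gamma>)"
  define \<delta> where "\<delta> = 1 - q"
  have q: "q > 0" "q powr (- \<gamma>) = 5 / 4"
    using assms by (auto simp: q_def powr_powr)
  have "q < 1"
    using assms by (simp add: q_def powr_less_one)
  then have \<delta>: "\<delta> > 0" by (simp add: \<delta>_def)
  have u0: "u n \<ge> 0" for n by (simp add: u_def)
  have "u \<longlonglongrightarrow> 0"
    unfolding u_def using assms(1)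
    by (intro tendsto_neg_powr filterlim_compose[OF filterlim_real_sequentially] filterlim_Suc) auto
  from tendsto_mult_right_zero[OF cesaro_mean_null[OF this], of "C * \<delta> powr (- \<gamma> - 1)"]
  have "\<forall>\<^sub>F n in sequentially. C * \<delta> powr (- \<gamma> - 1) * ((\<Sum>j\<le>n. u j) / real (Suc n)) < 1 / 8"
    by (rule order_tendstoD) simp
  then show ?thesis
  proof eventually_elim
    case (elim n)
    define v where "v = \<delta> powr (- \<gamma> - 1) * (u n / real (Suc n))"
    have v: "(\<delta> * real (Suc n)) powr (- \<gamma> - 1) = v"
      using \<delta> by (simp add: v_def u_def powr_mult powr_diff)
    have split: "(s + real k) powr (- \<gamma> - 1) * u (n - k) \<le>
        5 / 4 * u n * (s + real k) powr (- \<gamma> - 1) + v * u (n - k)" if "k \<in> {1..n}" for k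
    proof (cases "real k \<le> \<delta> * real (Suc n)")
      case True
      have "u (n - k) \<le> (q * real (Suc n)) powr (- \<gamma>)"
        unfolding u_def using True that q(1) assms
        by (intro powr_mono2' mult_pos_pos) (auto simp: \<delta>_def algebra_simps)
      also have "\<dots> = 5 / 4 * u n"
        using q by (simp add: u_def powr_mult)
      finally have "(s + real k) powr (- \<gamma> - 1) * u (n - k) \<le> (s + real k) powr (- \<gamma> - 1) * (5 / 4 * u n)"
        by (intro mult_left_mono) auto
      moreover have "v * u (n - k) \<ge> 0" using u0 by (simp add: v_def)
      ultimately show ?thesis by (simp add: mult_ac)
    next
      case False
      have "(s + real k) powr (- \<gamma> - 1) \<le> v"
        unfolding v[symmetric] using False \<delta> assms by (intro powr_mono2') auto
      then have "(s + real k) powr (- \<gamma> - 1) * u (n - k) \<le> v * u (n - k)"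
        using u0 by (rule mult_right_mono)
      moreover have "5 / 4 * u n * (s + real k) powr (- \<gamma> - 1) \<ge> 0" using u0 by simp
      ultimately show ?thesis by linarith
    qed
    have "(\<Sum>k=1..n. (s + real k) powr (- \<gamma> - 1) * u (n - k))
        \<le> (\<Sum>k=1..n. 5 / 4 * u n * (s + real k) powr (- \<gamma> - 1) + v * u (n - k))"
      by (rule sum_mono[OF split])
    also have "\<dots> = 5 / 4 * u n * (\<Sum>k=1..n. (s + real k) powr (- \<gamma> - 1)) + v * (\<Sum>k=1..n. u (n - k))"
      by (simp only: sum.distrib sum_distrib_left)
    also have "\<dots> \<le> 5 / 4 * u n * (s powr (- \<gamma>) / \<gamma>) + v * (\<Sum>j\<le>n. u j)"
    proof (intro add_mono mult_left_mono sum_shifted_powr_le)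
      have "(\<Sum>k=1..n. u (n - k)) = (\<Sum>j\<in>{..<n}. u j)"
        by (rule sum.reindex_bij_witness[of _ "\<lambda>j. n - j" "\<lambda>k. n - k"]) auto
      also have "\<dots> \<le> (\<Sum>j\<le>n. u j)" using u0 by (intro sum_mono2) auto
      finally show "(\<Sum>k=1..n. u (n - k)) \<le> (\<Sum>j\<le>n. u j)" .
    qed (use assms u0 in \<open>auto simp: v_def\<close>)
    finally have "C * (\<Sum>k=1..n. (s + real k) powr (- \<gamma> - 1) * u (n - k))
        \<le> C * (5 / 4 * u n * (s powr (- \<gamma>) / \<gamma>) + v * (\<Sum>j\<le>n. u j))"
      using assms by (intro mult_left_mono) auto
    also have "\<dots> = 5 / 4 * u n * (C * (s powr (- \<gamma>) / \<gamma>)) +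
        u n * (C * \<delta> powr (- \<gamma> - 1) * ((\<Sum>j\<le>n. u j) / real (Suc n)))"
      by (simp add: v_def algebra_simps)
    also have "\<dots> \<le> 5 / 4 * u n * (1 / 2) + u n * (1 / 8)"
      using C elim u0 by (intro add_mono mult_left_mono) auto
    finally show ?case by (simp add: u_def)
  qed
qed

text \<open>Inserting the claimed bound into the recursion gives the factor (1 - \<epsilon>) +
  \<epsilon> * (1/8 + 3/4) = 1 - \<epsilon>/8. For large n this gain exceeds the loss of the power
  when its argument grows by the fixed step \<open>N\<close>. The constant \<open>A\<close> is fixed
  before \<open>D\<close> and \<open>H\<close>, as uniformity over all functions requires.\<close>

lemma renewal_powr_bound:
  fixes \<gamma> \<epsilon> C s b :: real and N :: nat
  assumes "\<gamma> > 0" "0 < \<epsilon>" "\<epsilon> \<le> 1" "s \<ge> 1" "C \<ge> 0" "N \<ge> 1" "b \<ge> 0"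
    and C: "C * (s powr (- \<gamma>) / \<gamma>) \<le> 1 / 2"
  shows "\<exists>A>0. \<forall>D H. H \<ge> 0 \<longrightarrow> (\<forall>n. D n \<le> b * H) \<longrightarrow>
    (\<forall>n. D (n + N) \<le> (1 - \<epsilon>) * D n + \<epsilon> * (b * H * (s + real n) powr (- \<gamma>)
       + C * (\<Sum>k=1..n. (s + real k) powr (- \<gamma> - 1) * D (n - k)))) \<longrightarrow>
    (\<forall>n. D n \<le> A * H * real (Suc n) powr (- \<gamma>))"
proof -
  define u where "u n = real (Suc n) powr (- \<gamma>)" for n
  have u0: "u n > 0" for n by (simp add: u_def)
  have "(\<lambda>n. (real (Suc n) / real (Suc (n + N))) powr \<gamma>) \<longlonglongrightarrow> 1 powr \<gamma>"
  proof (intro tendsto_powr tendsto_const)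
    have "(\<lambda>n. 1 - real N * inverse (real (Suc (n + N)))) \<longlonglongrightarrow> 1 - real N * 0"
      by (intro tendsto_intros LIMSEQ_ignore_initial_segment[OF LIMSEQ_inverse_real_of_nat])
    moreover have "1 - real N * inverse (real (Suc (n + N))) = real (Suc n) / real (Suc (n + N))" for n
      by (simp add: field_simps)
    ultimately show "(\<lambda>n. real (Suc n) / real (Suc (n + N))) \<longlonglongrightarrow> 1" by simp
  qed simp
  then have "\<forall>\<^sub>F n in sequentially. (real (Suc n) / real (Suc (n + N))) powr \<gamma> > 1 - \<epsilon> / 8"
    by (rule order_tendstoD) (use assms in simp)
  then have "\<forall>\<^sub>F n in sequentially. (1 - \<epsilon> / 8) * u n \<le> u (n + N)"
  proof eventually_elim
    case (elim n)
    then have "(1 - \<epsilon> / 8) * u n \<le> (real (Suc n) / real (Suc (n + N))) powr \<gamma> * u n"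
      using u0[of n] by (intro mult_right_mono) auto
    also have "\<dots> = u (n + N)"
      by (simp add: u_def powr_divide powr_minus_divide)
    finally show ?case .
  qed
  from eventually_conj[OF this convolution_powr_le[OF assms(1,4,5) C]]
  obtain n0 where n0: "\<And>n. n \<ge> n0 \<Longrightarrow> (1 - \<epsilon> / 8) * u n \<le> u (n + N)"
    "\<And>n. n \<ge> n0 \<Longrightarrow> C * (\<Sum>k=1..n. (s + real k) powr (- \<gamma> - 1) * u (n - k)) \<le> 3 / 4 * u n"
    unfolding u_def eventually_sequentially by blast
  \<comment> \<open>The first summand makes the forcing term at most 1/8 of the claimed bound, the
    second covers all indices below \<open>n0 + N\<close>, the third ensures positivity.\<close>
  define A where "A = 8 * b + b / u (n0 + N) + 1"
  have A: "A > 0" "8 * b \<le> A" "b \<le> A * u (n0 + N)"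
    using assms(7) u0[of "n0 + N"] divide_nonneg_pos[OF assms(7) u0[of "n0 + N"]]
    by (auto simp: A_def distrib_right intro: add_nonneg_pos)
  have "D n \<le> A * H * u n"
    if H: "H \<ge> 0" and bd: "\<And>n. D n \<le> b * H"
      and rec: "\<And>n. D (n + N) \<le> (1 - \<epsilon>) * D n + \<epsilon> * (b * H * (s + real n) powr (- \<gamma>)
       + C * (\<Sum>k=1..n. (s + real k) powr (- \<gamma> - 1) * D (n - k)))" for D H n
  proof (induction n rule: less_induct)
    case (less m)
    show ?case
    proof (cases "m < n0 + N")
      case True
      have "D m \<le> b * H" by (rule bd)
      also have "\<dots> \<le> A * u (n0 + N) * H" using A H by (intro mult_right_mono) auto
      also have "\<dots> \<le> A * u m * H"
        using True A H assms(1) unfolding u_def by (intro mult_right_mono mult_left_mono powr_mono2') auto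
      finally show ?thesis by (simp add: mult_ac)
    next
      case False
      define n where "n = m - N"
      have n: "m = n + N" "n \<ge> n0" using False by (auto simp: n_def)
      have IH: "D j \<le> A * H * u j" if "j \<le> n" for j
        using less.IH[of j] that n assms(6) by auto
      have su: "(s + real n) powr (- \<gamma>) \<le> u n"
        unfolding u_def using assms by (intro powr_mono2') auto
      have "b * H * (s + real n) powr (- \<gamma>) \<le> A / 8 * H * u n"
        using A(2) H su assms(7) by (intro mult_mono) auto
      moreover have "C * (\<Sum>k=1..n. (s + real k) powr (- \<gamma> - 1) * D (n - k)) \<le> 3 / 4 * (A * H * u n)"
      proof -
        have "C * (\<Sum>k=1..n. (s + real k) powr (- \<gamma> - 1) * D (n - k))
            \<le> C * (\<Sum>k=1..n. (s + real k) powr (- \<gamma> - 1) * (A * H * u (n - k)))"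
          using IH assms by (intro mult_left_mono sum_mono) auto
        also have "\<dots> = A * H * (C * (\<Sum>k=1..n. (s + real k) powr (- \<gamma> - 1) * u (n - k)))"
          by (simp add: sum_distrib_left mult_ac)
        also have "\<dots> \<le> A * H * (3 / 4 * u n)"
          using A H n0(2)[OF n(2)] by (intro mult_left_mono) auto
        finally show ?thesis by simp
      qed
      ultimately have "\<epsilon> * (b * H * (s + real n) powr (- \<gamma>)
          + C * (\<Sum>k=1..n. (s + real k) powr (- \<gamma> - 1) * D (n - k))) \<le> \<epsilon> * (7 / 8 * (A * H * u n))"
        using assms by (intro mult_left_mono) auto
      moreover have "(1 - \<epsilon>) * D n \<le> (1 - \<epsilon>) * (A * H * u n)"
        using IH[of n] assms by (intro mult_left_mono) auto
      ultimately have "D m \<le> (1 - \<epsilon>) * (A * H * u n) + \<epsilon> * (7 / 8 * (A * H * u n))"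
        using rec[of n] unfolding n(1) by linarith
      also have "\<dots> = A * H * ((1 - \<epsilon> / 8) * u n)" by (simp add: algebra_simps)
      also have "\<dots> \<le> A * H * u m"
        unfolding n(1) using n0(1)[OF n(2)] A H by (intro mult_left_mono) auto
      finally show ?thesis .
    qed
  qed
  with A(1) show ?thesis by (auto simp: u_def)
qed

section \<open>Normalized Ruelle operators\<close>

definition oscillation :: "('a \<Rightarrow> real) \<Rightarrow> real" where
  "oscillation g = (SUP p. \<bar>g (fst p) - g (snd p)\<bar>)"

text \<open>\<open>B\<close> enters only to make the real-valued supremum genuine; its size is
  irrelevant.\<close>

lemma abs_diff_le_oscillation:
  assumes "\<And>x y. \<bar>g x - g y\<bar> \<le> B"
  shows "\<bar>g x - g y\<bar> \<le> oscillation g"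
  unfolding oscillation_def using assms
  by (intro cSUP_upper2[of _ _ "(x, y)"]) (auto intro!: bdd_aboveI[of _ B])

lemma oscillation_le:
  assumes "\<And>x y. \<bar>g x - g y\<bar> \<le> B"
  shows "oscillation g \<le> B"
  unfolding oscillation_def using assms by (intro cSUP_least) auto

text \<open>Normalization turns \<open>L\<close> into an average over random preimages with
  probabilities \<open>exp (a y)\<close>. The facts of this locale rest on that alone, without a
  metric.\<close>

locale normalized_operator =
  fixes T :: "'a \<Rightarrow> 'a" and a :: "'a \<Rightarrow> real"
  assumes normalized: "ruelle_operator T a (\<lambda>_. 1) = (\<lambda>_. 1)"
begin

abbreviation "L \<equiv> ruelle_operator T a"
abbreviation "fibre x \<equiv> {y. T y = x}"

lemma sum_weights: "(\<Sum>y\<in>fibre x. exp (a y)) = 1"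
  using fun_cong[OF normalized, of x] by (simp add: ruelle_operator_def)

text \<open>A sum over an infinite set is \<open>0\<close>, so normalization alone forces finite nonempty fibres.\<close>

lemma finite_fibre: "finite (fibre x)"
  using sum_weights[of x] by (metis (no_types) sum.infinite zero_neq_one)

lemma surj: "\<exists>y. T y = x"
proof (rule ccontr)
  assume "\<nexists>y. T y = x"
  then have "fibre x = {}" by blast
  with sum_weights[of x] show False by simp
qed

lemma surj_funpow: "\<exists>y. (T ^^ n) y = x"
proof (induction n arbitrary: x)
  case (Suc n)
  then show ?case using surj[of x] by (metis funpow.simps(2) o_apply)
qed simp

lemma L_diff_const: "c - L g x = (\<Sum>y\<in>fibre x. exp (a y) * (c - g y))"
proof -
  have "(\<Sum>y\<in>fibre x. exp (a y) * (c - g y)) = (\<Sum>y\<in>fibre x. exp (a y)) * c - L g x"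
    by (simp only: right_diff_distrib sum_subtractf ruelle_operator_def sum_distrib_right)
  then show ?thesis by (simp add: sum_weights)
qed

lemma L_uminus: "(L ^^ n) (\<lambda>y. - g y) = (\<lambda>x. - (L ^^ n) g x)"
  by (induction n) (simp_all add: ruelle_operator_def sum_negf)

text \<open>\<open>M - (L ^^ n) g x\<close> averages the nonnegative function \<open>M - g\<close>
  over the inverse branches of length \<open>n\<close>. Only the branch ending in \<open>z\<close>
  is kept; its probability is at least \<open>exp (- A)\<close> per step.\<close>

lemma funpow_L_weight_ge:
  assumes "\<And>y. a y \<ge> - A" "\<And>y. g y \<le> M" "(T ^^ n) z = x"
  shows "(M - g z) * exp (- A * real n) \<le> M - (L ^^ n) g x"
  using assms(3)
proof (induction n arbitrary: x)
  case (Suc n)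
  have pos: "M - (L ^^ n) g y \<ge> 0" for y
  proof (induction n arbitrary: y)
    case 0
    show ?case using assms(2)[of y] by simp
  next
    case (Suc n)
    show ?case using Suc by (auto simp: L_diff_const[of M] intro!: sum_nonneg)
  qed
  let ?y = "(T ^^ n) z"
  have "(M - g z) * exp (- A * real (Suc n)) = exp (- A) * ((M - g z) * exp (- A * real n))"
    by (simp add: exp_add[symmetric] algebra_simps)
  also have "\<dots> \<le> exp (a ?y) * (M - (L ^^ n) g ?y)"
    using Suc.IH[OF refl] assms(1)[of ?y] assms(2)[of z] by (intro mult_mono) auto
  also have "\<dots> \<le> (\<Sum>y\<in>fibre x. exp (a y) * (M - (L ^^ n) g y))"
    using Suc.prems pos by (intro member_le_sum finite_fibre) auto
  also have "\<dots> = M - (L ^^ Suc n) g x"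
    by (simp add: L_diff_const[symmetric])
  finally show ?case .
qed simp

lemma funpow_L_weight_le:
  assumes "\<And>y. a y \<ge> - A" "\<And>y. g y \<ge> m" "(T ^^ n) z = x"
  shows "(g z - m) * exp (- A * real n) \<le> (L ^^ n) g x - m"
  using funpow_L_weight_ge[of A "\<lambda>y. - g y" "- m" n z x] assms by (simp add: L_uminus)

lemma funpow_L_le:
  assumes "\<And>y. g y \<le> M"
  shows "(L ^^ n) g x \<le> M"
proof (induction n arbitrary: x)
  case (Suc n)
  have "M - L ((L ^^ n) g) x \<ge> 0"
    unfolding L_diff_const using Suc by (intro sum_nonneg) simp
  then show ?case by simp
qed (simp add: assms)

lemma funpow_L_ge:
  assumes "\<And>y. g y \<ge> m"
  shows "(L ^^ n) g x \<ge> m"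
  using funpow_L_le[of "\<lambda>y. - g y" "- m" n x] assms by (simp add: L_uminus)

text \<open>The left side is a lower bound for the probability of one inverse branch. The test
  function 0 with upper bound 1 expresses that this probability is at most 1.\<close>

lemma exp_lower_bound_le_1:
  assumes "\<And>y. a y \<ge> - A"
  shows "exp (- A * real n) \<le> 1"
proof -
  obtain z where z: "(T ^^ n) z = undefined" using surj_funpow by blast
  from funpow_L_weight_ge[of A "\<lambda>_. 0" 1 n z, OF assms _ z]
  have "exp (- A * real n) \<le> 1 - (L ^^ n) (\<lambda>_. 0) undefined" by simp
  also have "\<dots> \<le> 1" using funpow_L_ge[of 0 "\<lambda>_. 0"] by simp
  finally show ?thesis .
qed

lemma funpow_L_oscillation:
  assumes "\<And>x y. \<bar>g x - g y\<bar> \<le> B"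
  shows "\<bar>(L ^^ n) g x - g y\<bar> \<le> B"
proof -
  have "g u \<le> g y + B" "g y - B \<le> g u" for u
    using assms[of u y] by linarith+
  from funpow_L_le[of g "g y + B" n x, OF this(1)] funpow_L_ge[of "g y - B" g n x, OF this(2)]
  show ?thesis by linarith
qed

text \<open>A Doeblin argument: a part \<open>exp (- A * real n)\<close> of the mass is placed at
  \<open>x'\<close> and \<open>y'\<close>, where \<open>g\<close> differs by at most
  \<open>E\<close>; the remaining mass contributes at most the full oscillation.\<close>

lemma oscillation_contract:
  assumes A: "\<And>y. a y \<ge> - A" and B: "\<And>x y. \<bar>g x - g y\<bar> \<le> B"
    and coup: "\<And>x y. \<exists>x' y'. (T ^^ n) x' = x \<and> (T ^^ n) y' = y \<and> \<bar>g x' - g y'\<bar> \<le> E"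
  shows "oscillation ((L ^^ n) g) \<le> (1 - exp (- A * real n)) * oscillation g + exp (- A * real n) * E"
proof (rule oscillation_le)
  let ?e = "exp (- A * real n)"
  note osc = abs_diff_le_oscillation[of g B, OF B]
  define M where "M = (SUP x. g x)"
  \<comment> \<open>Any lower bound of \<open>g\<close> would do; this one makes
    \<open>M - m\<close> equal to the oscillation by definition.\<close>
  define m where "m = M - oscillation g"
  have bdd: "bdd_above (range g)"
  proof (rule bdd_aboveI2)
    show "g x \<le> g undefined + B" for x using B[of x undefined] by linarith
  qed
  have M: "g y \<le> M" for y unfolding M_def using bdd by (intro cSUP_upper) auto
  have m: "m \<le> g y" for y
  proof -
    have "M \<le> g y + oscillation g"
      unfolding M_def
    proof (rule cSUP_least)
      show "g x \<le> g y + oscillation g" for x using osc[of x y] by linarith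
    qed simp
    then show ?thesis by (simp add: m_def)
  qed
  have le: "(L ^^ n) g x - (L ^^ n) g y \<le> (1 - ?e) * oscillation g + ?e * E" for x y
  proof -
    obtain x' y' where xy: "(T ^^ n) x' = x" "(T ^^ n) y' = y" "\<bar>g x' - g y'\<bar> \<le> E"
      using coup by blast
    have "(L ^^ n) g x - (L ^^ n) g y \<le> (M - m) - ?e * (M - m) + ?e * (g x' - g y')"
      using funpow_L_weight_ge[of A g M n x' x, OF A M xy(1)]
        funpow_L_weight_le[of A m g n y' y, OF A m xy(2)]
      by (simp add: algebra_simps)
    also have "\<dots> \<le> (M - m) - ?e * (M - m) + ?e * E"
      using xy(3) by (intro add_left_mono mult_left_mono) auto
    finally show ?thesis by (simp add: m_def algebra_simps)
  qed
  show "\<bar>(L ^^ n) g x - (L ^^ n) g y\<bar> \<le> (1 - ?e) * oscillation g + ?e * E" for x y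
    using le[of x y] le[of y x] by linarith
qed

text \<open>Both families of weights sum to 1, so subtracting the constant \<open>g z\<close> from
  the values costs nothing. The error in the weights is then multiplied by the oscillation of
  \<open>g\<close> and not by its size, and the oscillation is what decays.\<close>

lemma L_diff_le_of_matching:
  assumes \<phi>: "bij_betw \<phi> (fibre z) (fibre w)"
    and E: "\<And>y. T y = z \<Longrightarrow> \<bar>g y - g (\<phi> y)\<bar> \<le> E"
    and \<eta>: "\<And>y. T y = z \<Longrightarrow> \<bar>exp (a y) - exp (a (\<phi> y))\<bar> \<le> \<eta> * exp (a y)"
    and D: "\<And>u v. \<bar>g u - g v\<bar> \<le> D"
  shows "\<bar>L g z - L g w\<bar> \<le> E + \<eta> * D"
proof -
  let ?F = "fibre z"
  have reindex: "(\<Sum>y\<in>fibre w. h y) = (\<Sum>y\<in>?F. h (\<phi> y))" for h :: "'a \<Rightarrow> real"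
    by (rule sum.reindex_bij_betw[OF \<phi>, symmetric])
  have "L g z - L g w = (\<Sum>y\<in>?F. exp (a y) * g y) - (\<Sum>y\<in>?F. exp (a (\<phi> y)) * g (\<phi> y))
      - g z * ((\<Sum>y\<in>?F. exp (a y)) - (\<Sum>y\<in>?F. exp (a (\<phi> y))))"
    using sum_weights[of z] sum_weights[of w] by (simp add: ruelle_operator_def reindex)
  also have "\<dots> = (\<Sum>y\<in>?F. exp (a y) * (g y - g (\<phi> y)) + (exp (a y) - exp (a (\<phi> y))) * (g (\<phi> y) - g z))"
    by (simp add: sum.distrib sum_subtractf sum_distrib_left algebra_simps)
  also have "\<bar>\<dots>\<bar> \<le> (\<Sum>y\<in>?F. exp (a y) * (E + \<eta> * D))"
  proof (rule order_trans[OF sum_abs sum_mono])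
    fix y assume "y \<in> ?F"
    then have y: "T y = z" by simp
    have "\<bar>exp (a y) * (g y - g (\<phi> y))\<bar> \<le> exp (a y) * E"
      using E[OF y] by (simp add: abs_mult)
    moreover have "\<bar>(exp (a y) - exp (a (\<phi> y))) * (g (\<phi> y) - g z)\<bar> \<le> \<eta> * exp (a y) * D"
      unfolding abs_mult using \<eta>[OF y] D by (intro mult_mono) (auto intro: order_trans[OF abs_ge_zero])
    ultimately show "\<bar>exp (a y) * (g y - g (\<phi> y)) + (exp (a y) - exp (a (\<phi> y))) * (g (\<phi> y) - g z)\<bar>
        \<le> exp (a y) * (E + \<eta> * D)"
      by (simp add: algebra_simps)
  qed
  also have "\<dots> = E + \<eta> * D"
    by (simp only: sum_distrib_right[symmetric] sum_weights mult_1)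
  finally show ?thesis .
qed

section \<open>Random inverse orbits\<close>

definition preimage_pmf :: "'a \<Rightarrow> 'a pmf" where
  "preimage_pmf x = embed_pmf (\<lambda>y. if T y = x then exp (a y) else 0)"

lemma pmf_preimage: "pmf (preimage_pmf x) y = (if T y = x then exp (a y) else 0)"
  unfolding preimage_pmf_def
proof (rule pmf_embed_pmf)
  have "(\<integral>\<^sup>+ y. ennreal (if T y = x then exp (a y) else 0) \<partial>count_space UNIV)
      = (\<Sum>y\<in>fibre x. ennreal (if T y = x then exp (a y) else 0))"
    by (rule nn_integral_count_space') (auto simp: finite_fibre)
  also have "\<dots> = ennreal (\<Sum>y\<in>fibre x. exp (a y))"
    by (subst sum_ennreal[symmetric]) auto
  finally show "(\<integral>\<^sup>+ y. ennreal (if T y = x then exp (a y) else 0) \<partial>count_space UNIV) = 1"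
    by (simp add: sum_weights)
qed simp

lemma set_preimage_pmf: "set_pmf (preimage_pmf x) = fibre x"
  by (auto simp: set_pmf_eq pmf_preimage split: if_splits)

text \<open>The law of the end point of an inverse orbit of length n. Splitting off the step at
  \<open>x\<close> matches the unfolding of \<open>(L ^^ Suc n) f x\<close>, so expectations are
  iterates of \<open>L\<close>.\<close>

primrec iterated_preimage_pmf :: "nat \<Rightarrow> 'a \<Rightarrow> 'a pmf" where
  "iterated_preimage_pmf 0 x = return_pmf x"
| "iterated_preimage_pmf (Suc n) x = preimage_pmf x \<bind> iterated_preimage_pmf n"

lemma finite_iterated_preimage_pmf: "finite (set_pmf (iterated_preimage_pmf n x))"
  by (induction n arbitrary: x) (auto simp: set_preimage_pmf finite_fibre)

lemma expectation_iterated_preimage_pmf: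
  "measure_pmf.expectation (iterated_preimage_pmf n x) f = (L ^^ n) f x"
proof (induction n arbitrary: x)
  case (Suc n)
  have "measure_pmf.expectation (iterated_preimage_pmf (Suc n) x) f =
      (\<Sum>y\<in>fibre x. pmf (preimage_pmf x) y *\<^sub>R measure_pmf.expectation (iterated_preimage_pmf n y) f)"
    unfolding iterated_preimage_pmf.simps
    by (rule pmf_expectation_bind) (auto simp: finite_fibre finite_iterated_preimage_pmf set_preimage_pmf)
  then show ?case by (simp add: Suc.IH pmf_preimage ruelle_operator_def)
qed simp

end

section \<open>Decay of oscillations\<close>

text \<open>The factor \<open>exp u\<close> is kept on the right so that summation over a fibre
  meets weights of total mass 1.\<close>

lemma abs_exp_diff_le:
  fixes u v B :: real
  assumes "\<bar>u - v\<bar> \<le> B"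
  shows "\<bar>exp u - exp v\<bar> \<le> exp B * \<bar>u - v\<bar> * exp u"
proof -
  have *: "\<bar>exp w - 1\<bar> \<le> exp \<bar>w\<bar> * \<bar>w\<bar>" for w :: real
  proof (cases "w \<ge> 0")
    case True
    have "exp w * (1 + - w) \<le> exp w * exp (- w)"
      by (intro mult_left_mono exp_ge_add_one_self) auto
    then show ?thesis using True by (simp add: exp_minus algebra_simps)
  next
    case False
    have "1 + w \<le> exp w" by (rule exp_ge_add_one_self)
    moreover have "- w \<le> exp (- w) * - w"
      using False by (intro mult_le_cancel_right1[THEN iffD2]) auto
    ultimately have "1 - exp w \<le> exp (- w) * - w" by linarith
    then show ?thesis using False by simp
  qed
  have v: "exp u * exp (v - u) = exp v" by (simp add: exp_add[symmetric])
  have "exp u - exp v = - (exp u * (exp (v - u) - 1))"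
    by (simp only: right_diff_distrib v mult_1_right minus_diff_eq)
  then have "\<bar>exp u - exp v\<bar> = exp u * \<bar>exp (v - u) - 1\<bar>"
    by (simp only: abs_minus_cancel abs_mult abs_exp_cancel)
  also have "\<dots> \<le> exp u * (exp \<bar>v - u\<bar> * \<bar>v - u\<bar>)"
    using * by (intro mult_left_mono) auto
  also have "\<dots> \<le> exp u * (exp B * \<bar>v - u\<bar>)"
    using assms by (intro mult_left_mono mult_right_mono) auto
  finally show ?thesis by (simp add: mult_ac abs_minus_commute)
qed

lemma holder_boundD: "holder_bound \<omega> f H \<Longrightarrow> \<bar>f x - f y\<bar> \<le> H * \<omega> (dist x y)"
  and holder_bound_nonneg: "holder_bound \<omega> f H \<Longrightarrow> H \<ge> 0"
  by (auto simp: holder_bound_def)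

text \<open>The weight \<open>s t\<close> measures how many steps a pair of points at distance \<open>t\<close> is ahead of a
  pair at distance \<open>1\<close>; a relation \<open>P\<close> as in \<open>matching\<close> pairs the inverse orbits of two close points.\<close>

locale contracting_operator = normalized_operator T a
  for T :: "'a::metric_space \<Rightarrow> 'a" and a :: "'a \<Rightarrow> real" +
  fixes s :: "real \<Rightarrow> real" and \<omega> :: "real \<Rightarrow> real" and c :: "nat \<Rightarrow> real"
    and \<gamma> r A B :: real
  assumes cpt: "compact (UNIV :: 'a set)"
    and dist_le_1: "dist (x :: 'a) y \<le> 1"
    and mixing: "topologically_mixing T"
    and \<gamma>_pos: "\<gamma> > 0" and r_pos: "r > 0" and B_pos: "B > 0"
    and a_lower: "a x \<ge> - A"
    and s_ge_1: "0 < t \<Longrightarrow> t \<le> 1 \<Longrightarrow> s t \<ge> 1"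
    and s_antimono: "0 < t \<Longrightarrow> t \<le> u \<Longrightarrow> u \<le> 1 \<Longrightarrow> s u \<le> s t"
    and s_at_0: "filterlim s at_top (at_right 0)"
    and c_null: "c \<longlonglongrightarrow> 0"
    and \<omega>_0: "\<omega> 0 = 0" and \<omega>_le: "0 \<le> t \<Longrightarrow> t \<le> 1 \<Longrightarrow> \<omega> t \<le> B"
    and \<omega>_at_0: "(\<omega> \<longlongrightarrow> 0) (at_right 0)"
    and matching: "x \<noteq> y \<Longrightarrow> dist x y < r \<Longrightarrow> \<exists>P. P (0::nat) x y \<and> (\<forall>k z w. P k z w \<longrightarrow>
        dist z w \<le> c k \<and>
        \<omega> (dist z w) \<le> B * (s (dist x y) + real k) powr (- \<gamma>) \<and>
        \<bar>a z - a w\<bar> \<le> B * (s (dist x y) + real k) powr (- \<gamma> - 1) \<and>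
        (\<exists>\<phi>. bij_betw \<phi> {u. T u = z} {u. T u = w} \<and> (\<forall>u. T u = z \<longrightarrow> P (Suc k) u (\<phi> u))))"
begin

lemma holder_continuous:
  fixes f :: "'a \<Rightarrow> real"
  assumes "holder_bound \<omega> f H"
  shows "continuous_on UNIV f"
  unfolding continuous_on_iff
proof (intro ballI allI impI)
  fix x and e :: real assume "e > 0"
  have "((\<lambda>t. H * \<omega> t) \<longlongrightarrow> H * 0) (at_right 0)"
    by (intro tendsto_intros \<omega>_at_0)
  then have "\<forall>\<^sub>F t in at_right 0. H * \<omega> t < e"
    using \<open>e > 0\<close> by (intro order_tendstoD) auto
  then obtain d where d: "d > 0" "\<And>t. 0 < t \<Longrightarrow> t < d \<Longrightarrow> H * \<omega> t < e"
    by (auto simp: eventually_at_right_field)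
  have "dist (f y) (f x) < e" if "dist y x < d" for y
    using holder_boundD[OF assms, of y x] d(2)[of "dist y x"] that \<open>e > 0\<close> \<omega>_0
    by (cases "y = x") (auto simp: dist_real_def)
  with d(1) show "\<exists>d>0. \<forall>y\<in>UNIV. dist y x < d \<longrightarrow> dist (f y) (f x) < e" by blast
qed

lemma holder_diff_le:
  fixes f :: "'a \<Rightarrow> real"
  assumes "holder_bound \<omega> f H"
  shows "\<bar>f x - f y\<bar> \<le> B * H"
proof -
  have "H * \<omega> (dist x y) \<le> H * B"
    using holder_bound_nonneg[OF assms] dist_le_1 by (intro mult_left_mono \<omega>_le) auto
  with holder_boundD[OF assms, of x y] show ?thesis by (simp add: mult.commute)
qed

lemma iterate_diff_le:
  assumes "holder_bound \<omega> f H"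
  shows "\<bar>(L ^^ n) f x - (L ^^ n) f y\<bar> \<le> B * H"
proof (induction n arbitrary: x y)
  case 0
  show ?case using holder_diff_le[OF assms] by simp
next
  case (Suc n)
  have "\<bar>(L ^^ n) f u - (L ^^ Suc n) f y\<bar> \<le> B * H" for u
    using funpow_L_oscillation[of "(L ^^ n) f" "B * H" 1 y u, OF Suc.IH]
    by (simp add: abs_minus_commute)
  then have "(L ^^ n) f u \<le> (L ^^ Suc n) f y + B * H" "(L ^^ Suc n) f y - B * H \<le> (L ^^ n) f u" for u
    by (auto simp: abs_le_iff algebra_simps)
  from funpow_L_le[of "(L ^^ n) f" _ 1 x, OF this(1)] funpow_L_ge[of _ "(L ^^ n) f" 1 x, OF this(2)]
  show ?case by simp
qed

text \<open>The matching starts from the pair of end points and is followed down the orbit of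
  \<open>u\<close> in reverse. The absolute value covers the case of equal end points, since
  \<open>c n\<close> itself may be negative.\<close>

lemma lift_orbit:
  assumes "dist ((T ^^ n) u) x < r"
  shows "\<exists>x'. (T ^^ n) x' = x \<and> dist u x' \<le> \<bar>c n\<bar>"
proof (cases "(T ^^ n) u = x")
  case False
  obtain P where P: "P 0 ((T ^^ n) u) x" "\<And>k z w. P k z w \<Longrightarrow> dist z w \<le> c k"
    and step: "\<And>k z w. P k z w \<Longrightarrow>
      \<exists>\<phi>. bij_betw \<phi> {u. T u = z} {u. T u = w} \<and> (\<forall>u. T u = z \<longrightarrow> P (Suc k) u (\<phi> u))"
    using matching[OF False assms] by (elim exE conjE) blast
  \<comment> \<open>Here \<open>k\<close> counts the steps already matched and \<open>m\<close>
    those that remain before \<open>u\<close> is reached.\<close>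
  have "\<exists>w'. (T ^^ m) w' = w \<and> P (k + m) u w'" if "P k ((T ^^ m) u) w" for m k w
    using that
  proof (induction m arbitrary: k w)
    case (Suc m)
    from step[OF Suc.prems] obtain \<phi>
      where \<phi>: "bij_betw \<phi> {v. T v = (T ^^ Suc m) u} {v. T v = w}"
        "\<And>v. T v = (T ^^ Suc m) u \<Longrightarrow> P (Suc k) v (\<phi> v)" by blast
    have "T (\<phi> ((T ^^ m) u)) = w"
      using bij_betw_apply[OF \<phi>(1), of "(T ^^ m) u"] by simp
    moreover have "P (Suc k) ((T ^^ m) u) (\<phi> ((T ^^ m) u))" by (rule \<phi>(2)) simp
    from Suc.IH[OF this] obtain w' where "(T ^^ m) w' = \<phi> ((T ^^ m) u)" "P (Suc k + m) u w'" by blast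
    ultimately show ?case by (intro exI[of _ w']) simp
  qed simp
  from this[OF P(1)] obtain x' where "(T ^^ n) x' = x" "P n u x'" by auto
  with P(2)[of n u x'] show ?thesis by (intro exI[of _ x']) auto
qed (auto intro!: exI[of _ u])

text \<open>For large \<open>N\<close> mixing sends some point near a fixed \<open>p\<close> into
  each ball of a finite net. Lifting along that orbit moves the point by at most
  \<open>\<bar>c N\<bar>\<close>, so every point has an N-th preimage close to
  \<open>p\<close>.\<close>

lemma common_preimages:
  assumes "\<eta> > 0"
  shows "\<exists>N\<ge>1. \<forall>x y. \<exists>x' y'. (T ^^ N) x' = x \<and> (T ^^ N) y' = y \<and> dist x' y' < \<eta>"
proof -
  fix p :: 'a
  define V where "V = ball p (\<eta> / 4)"
  obtain K :: "'a set" where K: "finite K" "UNIV \<subseteq> (\<Union>z\<in>K. ball z (r / 2))"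
  proof (rule compactE_image[OF cpt, of UNIV "\<lambda>z. ball z (r / 2)"])
    show "(UNIV :: 'a set) \<subseteq> (\<Union>z\<in>UNIV. ball z (r / 2))"
    proof
      fix x :: 'a
      have "x \<in> ball x (r / 2)" using r_pos by simp
      then show "x \<in> (\<Union>z\<in>UNIV. ball z (r / 2))" by blast
    qed
  qed auto
  have "\<forall>\<^sub>F n in sequentially. (T ^^ n) -` ball z (r / 2) \<inter> V \<noteq> {}" for z
  proof -
    have "ball z (r / 2) \<noteq> {}" "V \<noteq> {}" using r_pos assms by (auto simp: V_def)
    then obtain k where k: "\<And>n. n > k \<Longrightarrow> (T ^^ n) -` ball z (r / 2) \<inter> V \<noteq> {}"
      using mixing unfolding topologically_mixing_def V_def by (metis open_ball)
    then show ?thesis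
      unfolding eventually_sequentially by (intro exI[of _ "Suc k"]) auto
  qed
  then have "\<forall>\<^sub>F n in sequentially. \<forall>z\<in>K. (T ^^ n) -` ball z (r / 2) \<inter> V \<noteq> {}"
    by (intro eventually_ball_finite K(1)) auto
  moreover have "\<forall>\<^sub>F n in sequentially. \<bar>c n\<bar> < \<eta> / 4"
    using tendsto_rabs_zero[OF c_null] assms by (intro order_tendstoD) auto
  moreover have "\<forall>\<^sub>F n in sequentially. n \<ge> 1"
    by (rule eventually_ge_at_top)
  ultimately have "\<forall>\<^sub>F N in sequentially. N \<ge> 1 \<and>
      (\<forall>z\<in>K. (T ^^ N) -` ball z (r / 2) \<inter> V \<noteq> {}) \<and> \<bar>c N\<bar> < \<eta> / 4"
    by eventually_elim auto
  then obtain N where N: "N \<ge> 1" "\<And>z. z \<in> K \<Longrightarrow> (T ^^ N) -` ball z (r / 2) \<inter> V \<noteq> {}" "\<bar>c N\<bar> < \<eta> / 4"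
    unfolding eventually_sequentially by blast
  have near: "\<exists>x'. (T ^^ N) x' = x \<and> dist p x' < \<eta> / 2" for x
  proof -
    obtain z where z: "z \<in> K" "x \<in> ball z (r / 2)" using K(2) by blast
    obtain u where u: "(T ^^ N) u \<in> ball z (r / 2)" "u \<in> V" using N(2)[OF z(1)] by blast
    have "dist ((T ^^ N) u) x < r"
      using u(1) z(2) dist_triangle3[of "(T ^^ N) u" x z] by simp
    from lift_orbit[OF this] obtain x' where x': "(T ^^ N) x' = x" "dist u x' \<le> \<bar>c N\<bar>" by blast
    with u(2) N(3) dist_triangle[of p x' u] show ?thesis
      by (intro exI[of _ x']) (auto simp: V_def)
  qed
  have "\<exists>x' y'. (T ^^ N) x' = x \<and> (T ^^ N) y' = y \<and> dist x' y' < \<eta>" for x y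
  proof -
    obtain x' y' where "(T ^^ N) x' = x" "dist p x' < \<eta> / 2" "(T ^^ N) y' = y" "dist p y' < \<eta> / 2"
      using near by blast
    with dist_triangle3[of x' y' p] show ?thesis by (intro exI[of _ x'] exI[of _ y']) auto
  qed
  with N(1) show ?thesis by blast
qed

text \<open>Each application of \<open>L\<close> compares weights at matched preimages; their
  relative error multiplies the oscillation of the iterate that is left. The sum starts at
  \<open>j = 1\<close> because the potential is evaluated at the preimages and never at
  \<open>x\<close>, \<open>y\<close>.\<close>

lemma iterate_local_diff_le:
  assumes f: "holder_bound \<omega> f H" and D: "\<And>m u v. \<bar>(L ^^ m) f u - (L ^^ m) f v\<bar> \<le> D m"
    and xy: "x \<noteq> y" "dist x y < r"
  defines "\<sigma> \<equiv> s (dist x y)"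
  shows "\<bar>(L ^^ n) f x - (L ^^ n) f y\<bar> \<le> B * H * (\<sigma> + real n) powr (- \<gamma>)
    + B * exp B * (\<Sum>j=1..n. (\<sigma> + real j) powr (- \<gamma> - 1) * D (n - j))"
proof -
  define C where "C = B * exp B"
  have \<sigma>: "\<sigma> \<ge> 1" unfolding \<sigma>_def using xy dist_le_1 by (intro s_ge_1) auto
  obtain P where P: "P 0 x y"
    "\<And>k z w. P k z w \<Longrightarrow> \<omega> (dist z w) \<le> B * (\<sigma> + real k) powr (- \<gamma>)"
    "\<And>k z w. P k z w \<Longrightarrow> \<bar>a z - a w\<bar> \<le> B * (\<sigma> + real k) powr (- \<gamma> - 1)"
    and step: "\<And>k z w. P k z w \<Longrightarrow>
      \<exists>\<phi>. bij_betw \<phi> {u. T u = z} {u. T u = w} \<and> (\<forall>u. T u = z \<longrightarrow> P (Suc k) u (\<phi> u))"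
    unfolding \<sigma>_def using matching[OF xy] by (elim exE conjE) blast
  \<comment> \<open>The depth \<open>k\<close> is general because the induction passes from a pair
    at depth \<open>k\<close> to its preimages at depth \<open>Suc k\<close>, which shifts all
    weights by one.\<close>
  have "\<bar>(L ^^ n) f z - (L ^^ n) f w\<bar> \<le> B * H * (\<sigma> + real (k + n)) powr (- \<gamma>)
    + C * (\<Sum>j=1..n. (\<sigma> + real (k + j)) powr (- \<gamma> - 1) * D (n - j))" if "P k z w" for k z w
    using that
  proof (induction n arbitrary: k z w)
    case 0
    have "\<bar>f z - f w\<bar> \<le> H * \<omega> (dist z w)" by (rule holder_boundD[OF f])
    also have "\<dots> \<le> H * (B * (\<sigma> + real k) powr (- \<gamma>))"
      using holder_bound_nonneg[OF f] P(2)[OF 0] by (intro mult_left_mono)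
    finally show ?case by (simp add: mult_ac)
  next
    case (Suc n)
    from step[OF Suc.prems] obtain \<phi> where \<phi>: "bij_betw \<phi> (fibre z) (fibre w)"
      "\<And>u. T u = z \<Longrightarrow> P (Suc k) u (\<phi> u)" by blast
    define E where "E = B * H * (\<sigma> + real (Suc k + n)) powr (- \<gamma>)
      + C * (\<Sum>j=1..n. (\<sigma> + real (Suc k + j)) powr (- \<gamma> - 1) * D (n - j))"
    define \<eta> where "\<eta> = C * (\<sigma> + real (Suc k)) powr (- \<gamma> - 1)"
    have "\<bar>L ((L ^^ n) f) z - L ((L ^^ n) f) w\<bar> \<le> E + \<eta> * D n"
    proof (rule L_diff_le_of_matching[OF \<phi>(1)])
      fix u assume u: "T u = z"
      show "\<bar>(L ^^ n) f u - (L ^^ n) f (\<phi> u)\<bar> \<le> E"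
        unfolding E_def by (rule Suc.IH[OF \<phi>(2)[OF u]])
      have au: "\<bar>a u - a (\<phi> u)\<bar> \<le> B * (\<sigma> + real (Suc k)) powr (- \<gamma> - 1)"
        by (rule P(3)[OF \<phi>(2)[OF u]])
      \<comment> \<open>A crude bound by 1 suffices here: it gives a uniform bound \<open>B\<close>
        on the difference of potentials, hence the factor \<open>exp B\<close> in
        \<open>C\<close>.\<close>
      have "(\<sigma> + real (Suc k)) powr (- \<gamma> - 1) \<le> (\<sigma> + real (Suc k)) powr 0"
        using \<sigma> \<gamma>_pos by (intro powr_mono) auto
      then have "(\<sigma> + real (Suc k)) powr (- \<gamma> - 1) \<le> 1"
        using \<sigma> by simp
      then have "B * (\<sigma> + real (Suc k)) powr (- \<gamma> - 1) \<le> B * 1"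
        using B_pos by (intro mult_left_mono) auto
      with au have "\<bar>exp (a u) - exp (a (\<phi> u))\<bar> \<le> exp B * \<bar>a u - a (\<phi> u)\<bar> * exp (a u)"
        by (intro abs_exp_diff_le) auto
      also have "\<dots> \<le> exp B * (B * (\<sigma> + real (Suc k)) powr (- \<gamma> - 1)) * exp (a u)"
        using au by (intro mult_right_mono mult_left_mono) auto
      finally show "\<bar>exp (a u) - exp (a (\<phi> u))\<bar> \<le> \<eta> * exp (a u)"
        by (simp add: \<eta>_def C_def mult_ac)
    qed (rule D)
    also have "E + \<eta> * D n = B * H * (\<sigma> + real (k + Suc n)) powr (- \<gamma>)
      + C * (\<Sum>j=1..Suc n. (\<sigma> + real (k + j)) powr (- \<gamma> - 1) * D (Suc n - j))"
    proof -
      have "(\<Sum>j=1..Suc n. (\<sigma> + real (k + j)) powr (- \<gamma> - 1) * D (Suc n - j)) =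
          (\<sigma> + real (Suc k)) powr (- \<gamma> - 1) * D n
          + (\<Sum>j=1..n. (\<sigma> + real (Suc k + j)) powr (- \<gamma> - 1) * D (n - j))"
        by (subst sum.atLeast_Suc_atMost) (simp_all only: One_nat_def sum.shift_bounds_cl_Suc_ivl, simp_all)
      then show ?thesis
        by (simp only: E_def \<eta>_def distrib_left add_Suc_right add_Suc mult_ac add_ac)
    qed
    finally show ?case by simp
  qed
  from this[OF P(1)] show ?thesis by (simp add: C_def)
qed

text \<open>Mixing brings any two points within distance \<open>r'\<close> of each other with positive probability,
  and \<open>r'\<close> is so small that the matching of their inverse orbits is then lost with probability at
  most \<open>1/2\<close>. This gives a defective renewal inequality for the oscillations.\<close>

lemma oscillation_decay:
  "\<exists>A'>0. \<forall>f H n x y. holder_bound \<omega> f H \<longrightarrow>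
     \<bar>(L ^^ n) f x - (L ^^ n) f y\<bar> \<le> A' * H * real (Suc n) powr (- \<gamma>)"
proof -
  define C where "C = B * exp B"
  have C: "C > 0" using B_pos by (simp add: C_def)
  \<comment> \<open>The expression bounds \<open>C\<close> times the total mass of the weights for
    pairs at distance \<open>t\<close>; it falls below 1/2 because \<open>s\<close> tends to
    infinity at 0.\<close>
  have "((\<lambda>t. C * (s t powr (- \<gamma>) / \<gamma>)) \<longlongrightarrow> C * (0 / \<gamma>)) (at_right 0)"
    using \<gamma>_pos by (intro tendsto_intros tendsto_neg_powr s_at_0) auto
  then have "\<forall>\<^sub>F t in at_right 0. C * (s t powr (- \<gamma>) / \<gamma>) < 1 / 2"
    by (rule order_tendstoD) simp
  moreover have "\<forall>\<^sub>F t in at_right 0. t \<in> {0<..<min r 1}"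
    using r_pos by (intro eventually_at_right_real) auto
  ultimately have "\<forall>\<^sub>F t in at_right 0. C * (s t powr (- \<gamma>) / \<gamma>) < 1 / 2 \<and> t \<in> {0<..<min r 1}"
    by eventually_elim auto
  from eventually_happens[OF this]
  obtain r' where "C * (s r' powr (- \<gamma>) / \<gamma>) < 1 / 2" "r' \<in> {0<..<min r 1}"
    by (auto simp: trivial_limit_at_right_real)
  then have r': "C * (s r' powr (- \<gamma>) / \<gamma>) \<le> 1 / 2" "0 < r'" "r' < r" "r' < 1"
    by auto
  define s0 where "s0 = s r'"
  have s0: "s0 \<ge> 1" unfolding s0_def using r' by (intro s_ge_1) auto
  obtain N where N: "N \<ge> 1"
    and close: "\<And>x y. \<exists>x' y'. (T ^^ N) x' = x \<and> (T ^^ N) y' = y \<and> dist x' y' < r'"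
    using common_preimages[OF r'(2)] by blast
  define \<epsilon> where "\<epsilon> = exp (- A * real N)"
  have \<epsilon>: "0 < \<epsilon>" "\<epsilon> \<le> 1"
    using exp_lower_bound_le_1[OF a_lower, of N] by (simp_all only: \<epsilon>_def exp_gt_zero)
  from renewal_powr_bound[OF \<gamma>_pos \<epsilon> s0 less_imp_le[OF C] N less_imp_le[OF B_pos] r'(1)[folded s0_def]]
  obtain A' where A': "A' > 0" and renewal: "\<forall>D H. H \<ge> 0 \<longrightarrow> (\<forall>n. D n \<le> B * H) \<longrightarrow>
    (\<forall>n. D (n + N) \<le> (1 - \<epsilon>) * D n + \<epsilon> * (B * H * (s0 + real n) powr (- \<gamma>)
       + C * (\<Sum>k=1..n. (s0 + real k) powr (- \<gamma> - 1) * D (n - k)))) \<longrightarrow>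
    (\<forall>n. D n \<le> A' * H * real (Suc n) powr (- \<gamma>))"
    by (elim exE conjE)
  have "\<bar>(L ^^ n) f x - (L ^^ n) f y\<bar> \<le> A' * H * real (Suc n) powr (- \<gamma>)"
    if f: "holder_bound \<omega> f H" for f H n x y
  proof -
    define D where "D n = oscillation ((L ^^ n) f)" for n
    note H = holder_bound_nonneg[OF f]
    have le_D: "\<bar>(L ^^ m) f u - (L ^^ m) f v\<bar> \<le> D m" for m u v
      unfolding D_def by (rule abs_diff_le_oscillation[OF iterate_diff_le[OF f]])
    have D0: "D m \<ge> 0" for m using le_D[of m x x] by simp
    have "D n \<le> A' * H * real (Suc n) powr (- \<gamma>)"
    proof (rule renewal[rule_format, OF H])
      show "D m \<le> B * H" for m
        unfolding D_def by (rule oscillation_le[OF iterate_diff_le[OF f]])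
    next
      fix m
      define E where "E = B * H * (s0 + real m) powr (- \<gamma>)
        + C * (\<Sum>k=1..m. (s0 + real k) powr (- \<gamma> - 1) * D (m - k))"
      have E0: "E \<ge> 0"
        unfolding E_def using H B_pos C D0 by (intro add_nonneg_nonneg mult_nonneg_nonneg sum_nonneg) auto
      have diff: "\<bar>(L ^^ m) f x' - (L ^^ m) f y'\<bar> \<le> E" if d: "dist x' y' < r'" for x' y'
      proof (cases "x' = y'")
        case False
        define \<sigma> where "\<sigma> = s (dist x' y')"
        \<comment> \<open>Closer pairs have smaller weights, so one bound \<open>E\<close>, computed
          at distance \<open>r'\<close>, serves all of them.\<close>
        have \<sigma>: "s0 \<le> \<sigma>" unfolding s0_def \<sigma>_def using False d r' by (intro s_antimono) auto
        have "\<bar>(L ^^ m) f x' - (L ^^ m) f y'\<bar> \<le> B * H * (\<sigma> + real m) powr (- \<gamma>)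
            + C * (\<Sum>k=1..m. (\<sigma> + real k) powr (- \<gamma> - 1) * D (m - k))"
          unfolding \<sigma>_def C_def
          by (rule iterate_local_diff_le[OF f le_D False]) (use d r' in simp)
        also have "\<dots> \<le> E"
          unfolding E_def using \<sigma> s0 \<gamma>_pos C D0 H B_pos
          by (intro add_mono mult_left_mono mult_right_mono sum_mono powr_mono2') auto
        finally show ?thesis .
      qed (use E0 in simp)
      have "oscillation ((L ^^ N) ((L ^^ m) f)) \<le> (1 - exp (- A * real N)) * oscillation ((L ^^ m) f)
          + exp (- A * real N) * E"
      proof (rule oscillation_contract[OF a_lower iterate_diff_le[OF f]])
        fix u v
        obtain x' y' where "(T ^^ N) x' = u" "(T ^^ N) y' = v" "dist x' y' < r'"
          using close by blast
        then show "\<exists>x' y'. (T ^^ N) x' = u \<and> (T ^^ N) y' = v \<and> \<bar>(L ^^ m) f x' - (L ^^ m) f y'\<bar> \<le> E"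
          using diff by blast
      qed
      then show "D (m + N) \<le> (1 - \<epsilon>) * D m + \<epsilon> * (B * H * (s0 + real m) powr (- \<gamma>)
        + C * (\<Sum>k=1..m. (s0 + real k) powr (- \<gamma> - 1) * D (m - k)))"
        by (simp only: D_def \<epsilon>_def E_def add.commute[of m N] funpow_add o_apply)
    qed
    with le_D[of n x y] show ?thesis by linarith
  qed
  with A' show ?thesis by blast
qed

text \<open>With the constant bound \<open>B * H\<close> for all oscillations the weights simply add
  up to \<open>\<sigma> powr (- \<gamma>) / \<gamma>\<close>, uniformly in n. Pairs at distance at
  least \<open>r\<close> have bounded \<sigma>, so for them the trivial bound is already of the
  required form.\<close>

lemma iterate_regularity:
  "\<exists>A'>0. \<forall>f H n x y. holder_bound \<omega> f H \<longrightarrow> x \<noteq> y \<longrightarrow>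
     \<bar>(L ^^ n) f x - (L ^^ n) f y\<bar> \<le> A' * H * s (dist x y) powr (- \<gamma>)"
proof -
  define C where "C = B * exp B"
  have C: "C > 0" using B_pos by (simp add: C_def)
  define s1 where "s1 = s (min r 1)"
  have s1: "s1 \<ge> 1" unfolding s1_def using r_pos by (intro s_ge_1) auto
  \<comment> \<open>The last summand pays for the distant pairs, where \<sigma> is at most
    \<open>s1\<close>; the others come from the close pairs.\<close>
  define A' where "A' = B + C * B / \<gamma> + B * s1 powr \<gamma>"
  have parts: "B * s1 powr \<gamma> \<ge> 0" "C * B / \<gamma> \<ge> 0" using B_pos C \<gamma>_pos by auto
  have "\<bar>(L ^^ n) f x - (L ^^ n) f y\<bar> \<le> A' * H * s (dist x y) powr (- \<gamma>)"
    if f: "holder_bound \<omega> f H" and xy: "x \<noteq> y" for f H n x y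
  proof -
    define \<sigma> where "\<sigma> = s (dist x y)"
    have \<sigma>: "\<sigma> \<ge> 1" unfolding \<sigma>_def using xy dist_le_1 by (intro s_ge_1) auto
    note H = holder_bound_nonneg[OF f]
    show ?thesis
    proof (cases "dist x y < r")
      case True
      have "\<bar>(L ^^ n) f x - (L ^^ n) f y\<bar> \<le> B * H * (\<sigma> + real n) powr (- \<gamma>)
          + C * (\<Sum>j=1..n. (\<sigma> + real j) powr (- \<gamma> - 1) * (B * H))"
        unfolding \<sigma>_def C_def
        by (rule iterate_local_diff_le[OF f iterate_diff_le[OF f] xy True])
      also have "\<dots> \<le> B * H * \<sigma> powr (- \<gamma>) + C * (\<sigma> powr (- \<gamma>) / \<gamma> * (B * H))"
        unfolding sum_distrib_right[symmetric] using \<sigma> \<gamma>_pos B_pos H C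
        by (intro add_mono mult_left_mono mult_right_mono powr_mono2' sum_shifted_powr_le) auto
      also have "\<dots> = (B + C * B / \<gamma>) * (H * \<sigma> powr (- \<gamma>))"
        using \<gamma>_pos by (simp add: field_simps)
      also have "\<dots> \<le> A' * (H * \<sigma> powr (- \<gamma>))"
        using parts H by (intro mult_right_mono) (auto simp: A'_def)
      finally show ?thesis by (simp add: \<sigma>_def mult_ac)
    next
      case False
      have "\<sigma> \<le> s1"
        unfolding \<sigma>_def s1_def using False r_pos dist_le_1[of x y] by (intro s_antimono) auto
      then have "\<sigma> powr \<gamma> \<le> s1 powr \<gamma>" using \<sigma> \<gamma>_pos by (intro powr_mono2) auto
      then have "1 \<le> s1 powr \<gamma> * \<sigma> powr (- \<gamma>)"
        using \<sigma> by (simp add: powr_minus field_simps)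
      then have "B * H * 1 \<le> B * H * (s1 powr \<gamma> * \<sigma> powr (- \<gamma>))"
        using B_pos H by (intro mult_left_mono) auto
      also have "\<dots> = B * s1 powr \<gamma> * (H * \<sigma> powr (- \<gamma>))" by (simp only: mult_ac)
      also have "\<dots> \<le> A' * (H * \<sigma> powr (- \<gamma>))"
        using parts H B_pos by (intro mult_right_mono) (auto simp: A'_def)
      finally show ?thesis using iterate_diff_le[OF f, of n x y] by (simp add: \<sigma>_def mult_ac)
    qed
  qed
  moreover have "A' > 0" unfolding A'_def using parts B_pos by linarith
  ultimately show ?thesis by blast
qed

text \<open>Later iterates are averages of \<open>(L ^^ n) f\<close>, so they stay within its
  oscillation of each of its values. A limit along one subsequence, chosen independently of
  \<open>f\<close>, therefore controls all n.\<close>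

theorem spectral_decay:
  "\<exists>(\<mu> :: 'a measure) A'. prob_space \<mu> \<and> sets \<mu> = sets borel \<and> A' > 0 \<and>
     (\<forall>f H n. holder_bound \<omega> f H \<longrightarrow>
        (\<forall>x. \<bar>(L ^^ n) f x - integral\<^sup>L \<mu> f\<bar> \<le> A' * H * real (Suc n) powr (- \<gamma>)) \<and>
        (\<forall>x y. x \<noteq> y \<longrightarrow>
           \<bar>(L ^^ n) f x - (L ^^ n) f y\<bar> \<le> A' * H * (s (dist x y) + real n) powr (- \<gamma>)))"
proof -
  obtain A1 where A1: "A1 > 0" and osc: "\<And>f H n x y. holder_bound \<omega> f H \<Longrightarrow>
     \<bar>(L ^^ n) f x - (L ^^ n) f y\<bar> \<le> A1 * H * real (Suc n) powr (- \<gamma>)"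
    using oscillation_decay by blast
  obtain A2 where A2: "A2 > 0" and reg: "\<And>f H n x y. holder_bound \<omega> f H \<Longrightarrow> x \<noteq> y \<Longrightarrow>
     \<bar>(L ^^ n) f x - (L ^^ n) f y\<bar> \<le> A2 * H * s (dist x y) powr (- \<gamma>)"
    using iterate_regularity by blast
  define A' where "A' = max A1 A2 * 2 powr \<gamma>"
  have "(1 :: real) \<le> 2 powr \<gamma>" using \<gamma>_pos by (intro ge_one_powr_ge_zero) auto
  then have A': "A1 \<le> A'" "A' > 0"
    using A1 A2 mult_mono[of A1 "max A1 A2" 1 "2 powr \<gamma>"] by (auto simp: A'_def)
  obtain \<mu> :: "'a measure" and q where \<mu>: "prob_space \<mu>" "sets \<mu> = sets borel"
    and q: "strict_mono (q :: nat \<Rightarrow> nat)"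
    and lim: "\<And>f :: 'a \<Rightarrow> real. continuous_on UNIV f \<Longrightarrow>
      (\<lambda>n. (L ^^ q n) f undefined) \<longlonglongrightarrow> integral\<^sup>L \<mu> f"
    using pmf_weak_subsequence[OF cpt, of "\<lambda>n. iterated_preimage_pmf n undefined"]
    unfolding expectation_iterated_preimage_pmf by blast
  have "\<bar>(L ^^ n) f x - integral\<^sup>L \<mu> f\<bar> \<le> A' * H * real (Suc n) powr (- \<gamma>)"
    if f: "holder_bound \<omega> f H" for f H n x
  proof -
    have "\<bar>(L ^^ n) f x - integral\<^sup>L \<mu> f\<bar> \<le> A1 * H * real (Suc n) powr (- \<gamma>)"
    proof (rule tendsto_upperbound)
      show "(\<lambda>j. \<bar>(L ^^ n) f x - (L ^^ q j) f undefined\<bar>) \<longlonglongrightarrow> \<bar>(L ^^ n) f x - integral\<^sup>L \<mu> f\<bar>"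
        by (intro tendsto_intros lim holder_continuous[OF f])
      show "\<forall>\<^sub>F j in sequentially. \<bar>(L ^^ n) f x - (L ^^ q j) f undefined\<bar>
          \<le> A1 * H * real (Suc n) powr (- \<gamma>)"
        using eventually_ge_at_top[of n]
      proof eventually_elim
        case (elim j)
        have "n \<le> q j" using elim seq_suble[OF q, of j] by linarith
        then have "(L ^^ q j) f = (L ^^ (q j - n)) ((L ^^ n) f)"
          by (simp flip: funpow_add[THEN fun_cong, simplified o_apply])
        then show ?case
          using funpow_L_oscillation[of "(L ^^ n) f" _ "q j - n" undefined x, OF osc[OF f]]
          by (simp only: abs_minus_commute)
      qed
    qed simp
    also have "\<dots> \<le> A' * H * real (Suc n) powr (- \<gamma>)"
      using A' holder_bound_nonneg[OF f] by (intro mult_right_mono) auto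
    finally show ?thesis .
  qed
  moreover have "\<bar>(L ^^ n) f x - (L ^^ n) f y\<bar> \<le> A' * H * (s (dist x y) + real n) powr (- \<gamma>)"
    if f: "holder_bound \<omega> f H" and xy: "x \<noteq> y" for f H n x y
  proof -
    define \<sigma> where "\<sigma> = s (dist x y)"
    have \<sigma>: "\<sigma> \<ge> 1" unfolding \<sigma>_def using xy dist_le_1 by (intro s_ge_1) auto
    note H = holder_bound_nonneg[OF f]
    \<comment> \<open>The decay bound and the regularity bound together give the power
      \<open>- \<gamma>\<close> of this maximum. The maximum is at least half of
      \<open>\<sigma> + real n\<close>, which costs the factor \<open>2 powr \<gamma>\<close> in
      \<open>A'\<close>.\<close>
    define M where "M = max \<sigma> (real (Suc n))"
    have "M powr (- \<gamma>) \<le> ((\<sigma> + real n) / 2) powr (- \<gamma>)"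
    proof (rule powr_mono2')
      have "\<sigma> \<le> M" "real (Suc n) \<le> M" by (auto simp: M_def)
      then show "(\<sigma> + real n) / 2 \<le> M" by simp
    qed (use \<sigma> \<gamma>_pos in auto)
    also have "((\<sigma> + real n) / 2) powr (- \<gamma>) = 2 powr \<gamma> * (\<sigma> + real n) powr (- \<gamma>)"
      using \<sigma> by (simp add: powr_divide powr_minus field_simps)
    finally have M: "M powr (- \<gamma>) \<le> 2 powr \<gamma> * (\<sigma> + real n) powr (- \<gamma>)" .
    have "\<bar>(L ^^ n) f x - (L ^^ n) f y\<bar> \<le> max A1 A2 * H * M powr (- \<gamma>)"
    proof (cases "\<sigma> \<le> real (Suc n)")
      case True
      then have "M = real (Suc n)" by (simp add: M_def)
      moreover have "A1 * H * real (Suc n) powr (- \<gamma>) \<le> max A1 A2 * H * real (Suc n) powr (- \<gamma>)"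
        using H by (intro mult_right_mono) auto
      ultimately show ?thesis using osc[OF f, of n x y] by (simp only:)
    next
      case False
      then have "M = \<sigma>" by (simp add: M_def)
      moreover have "A2 * H * \<sigma> powr (- \<gamma>) \<le> max A1 A2 * H * \<sigma> powr (- \<gamma>)"
        using H by (intro mult_right_mono) auto
      ultimately show ?thesis using reg[OF f xy, of n] by (simp add: \<sigma>_def)
    qed
    also have "\<dots> \<le> max A1 A2 * H * (2 powr \<gamma> * (\<sigma> + real n) powr (- \<gamma>))"
      using H A1 M by (intro mult_left_mono) auto
    also have "\<dots> = A' * H * (s (dist x y) + real n) powr (- \<gamma>)"
      by (simp only: A'_def \<sigma>_def mult_ac)
    finally show ?thesis .
  qed
  ultimately show ?thesis using \<mu> A'(2) by blast
qed

end

section \<open>Moduli of continuity and the two cases\<close>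

text \<open>The infimum is attained: where the modulus is positive, the difference quotient is a
  lower bound of all admissible constants; where it vanishes, any one admissible constant forces the
  difference to be 0.\<close>

lemma holder_bound_holder_const:
  fixes f :: "'a::metric_space \<Rightarrow> real"
  assumes "is_holder \<omega> f" "\<And>x y :: 'a. \<omega> (dist x y) \<ge> 0"
  shows "holder_bound \<omega> f (holder_const \<omega> f)"
proof -
  define S where "S = {C. holder_bound \<omega> f C}"
  have S: "S \<noteq> {}" using assms(1) by (auto simp: S_def is_holder_def)
  have "Inf S \<ge> 0"
    using S by (intro cInf_greatest) (auto simp: S_def holder_bound_def)
  moreover have "\<bar>f x - f y\<bar> \<le> Inf S * \<omega> (dist x y)" for x y
  proof (cases "\<omega> (dist x y) = 0")
    case True
    obtain C where "holder_bound \<omega> f C" using assms(1) by (auto simp: is_holder_def)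
    from holder_boundD[OF this, of x y] True show ?thesis by simp
  next
    case False
    then have pos: "\<omega> (dist x y) > 0" using assms(2)[of x y] by simp
    have "\<bar>f x - f y\<bar> / \<omega> (dist x y) \<le> Inf S"
    proof (rule cInf_greatest[OF S])
      fix C assume "C \<in> S"
      then have "\<bar>f x - f y\<bar> \<le> C * \<omega> (dist x y)" by (simp add: S_def holder_boundD)
      then show "\<bar>f x - f y\<bar> / \<omega> (dist x y) \<le> C" using pos by (simp add: pos_divide_le_eq)
    qed
    then show ?thesis using pos by (simp add: pos_divide_le_eq)
  qed
  ultimately show ?thesis by (simp add: holder_bound_def holder_const_def S_def)
qed

lemma holder_const_le:
  assumes "holder_bound \<omega> f C"
  shows "holder_const \<omega> f \<le> C"
  unfolding holder_const_def
  by (rule cInf_lower) (use assms in \<open>auto simp: holder_bound_def intro!: bdd_belowI[of _ 0]\<close>)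

lemma sup_norm_le:
  assumes "\<And>x. \<bar>g x\<bar> \<le> B"
  shows "sup_norm g \<le> B"
  unfolding sup_norm_def using assms by (intro cSUP_least) auto

text \<open>The factor 2 in \<open>C\<close> allows one share for the sup norm and one for the
  Hoelder constant. Subtracting the mean does not change differences, so the latter is read off the
  iterates.\<close>

lemma (in contracting_operator) holder_norm_decay:
  fixes \<omega>' :: "nat \<Rightarrow> real \<Rightarrow> real"
  assumes \<omega>: "\<And>t. \<omega> t \<ge> 0"
    and \<omega>': "\<And>n. \<omega>' n 0 = 0"
      "\<And>n t. n \<ge> 1 \<Longrightarrow> 0 < t \<Longrightarrow> t \<le> 1 \<Longrightarrow> (s t + real n) powr (- \<gamma>) \<le> \<omega>' n t"
  shows "\<exists>(\<mu> :: 'a measure) C. prob_space \<mu> \<and> sets \<mu> = sets borel \<and> C > 0 \<and>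
    (\<forall>f n. is_holder \<omega> f \<longrightarrow> n \<ge> 1 \<longrightarrow>
       (let g = (\<lambda>x. (L ^^ n) f x - integral\<^sup>L \<mu> f) in
          bounded (range g) \<and> sup_norm g \<le> C * holder_const \<omega> f * real n powr (- \<gamma>) \<and>
          is_holder (\<omega>' n) g \<and> holder_norm (\<omega>' n) g \<le> C * holder_const \<omega> f))"
proof -
  obtain \<mu> :: "'a measure" and D where \<mu>: "prob_space \<mu>" "sets \<mu> = sets borel" and D: "D > 0"
    and decay: "\<forall>f H n. holder_bound \<omega> f H \<longrightarrow>
        (\<forall>x. \<bar>(L ^^ n) f x - integral\<^sup>L \<mu> f\<bar> \<le> D * H * real (Suc n) powr (- \<gamma>)) \<and>
        (\<forall>x y. x \<noteq> y \<longrightarrow>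
           \<bar>(L ^^ n) f x - (L ^^ n) f y\<bar> \<le> D * H * (s (dist x y) + real n) powr (- \<gamma>))"
    using spectral_decay by (elim exE conjE)
  have "bounded (range g) \<and> sup_norm g \<le> 2 * D * holder_const \<omega> f * real n powr (- \<gamma>) \<and>
      is_holder (\<omega>' n) g \<and> holder_norm (\<omega>' n) g \<le> 2 * D * holder_const \<omega> f"
    if f: "is_holder \<omega> f" and n: "n \<ge> 1" and g: "g = (\<lambda>x. (L ^^ n) f x - integral\<^sup>L \<mu> f)"
    for f :: "'a \<Rightarrow> real" and n g
  proof -
    define H where "H = holder_const \<omega> f"
    have hb: "holder_bound \<omega> f H" unfolding H_def by (rule holder_bound_holder_const[OF f \<omega>])
    have H: "H \<ge> 0" by (rule holder_bound_nonneg[OF hb])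
    have "real (Suc n) powr (- \<gamma>) \<le> real n powr (- \<gamma>)"
      using n \<gamma>_pos by (intro powr_mono2') auto
    then have "D * H * real (Suc n) powr (- \<gamma>) \<le> D * H * real n powr (- \<gamma>)"
      using D H by (intro mult_left_mono) auto
    then have sup: "\<bar>g x\<bar> \<le> D * H * real n powr (- \<gamma>)" for x
      using decay hb unfolding g by (meson order_trans)
    have bnd: "holder_bound (\<omega>' n) g (D * H)"
      unfolding holder_bound_def
    proof (intro conjI allI)
      fix x y
      show "\<bar>g x - g y\<bar> \<le> D * H * \<omega>' n (dist x y)"
      proof (cases "x = y")
        case False
        have "\<bar>g x - g y\<bar> \<le> D * H * (s (dist x y) + real n) powr (- \<gamma>)"
          using decay hb False unfolding g by simp
        also have "\<dots> \<le> D * H * \<omega>' n (dist x y)"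
          using D H False n dist_le_1 by (intro mult_left_mono \<omega>'(2)) auto
        finally show ?thesis .
      qed (simp add: \<omega>'(1))
    qed (use D H in simp)
    have "real n powr (- \<gamma>) \<le> 1 powr (- \<gamma>)"
      using n \<gamma>_pos by (intro powr_mono2') auto
    then have "D * H * real n powr (- \<gamma>) \<le> D * H * 1"
      using D H by (intro mult_left_mono) auto
    moreover have sn: "sup_norm g \<le> D * H * real n powr (- \<gamma>)" by (rule sup_norm_le[OF sup])
    moreover note holder_const_le[OF bnd]
    ultimately have "holder_norm (\<omega>' n) g \<le> 2 * D * H"
      unfolding holder_norm_def by linarith
    moreover have "bounded (range g)" using sup by (auto simp: bounded_iff)
    moreover have "sup_norm g \<le> 2 * D * H * real n powr (- \<gamma>)"
    proof -
      have "0 \<le> D * H * real n powr (- \<gamma>)" using D H by simp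
      with sn show ?thesis by linarith
    qed
    moreover have "is_holder (\<omega>' n) g" using bnd by (auto simp: is_holder_def)
    ultimately show ?thesis by (simp add: H_def)
  qed
  then show ?thesis
    using \<mu> D unfolding Let_def by (intro exI[of _ \<mu>] exI[of _ "2 * D"]) auto
qed

text \<open>Both Ruelle conditions are symmetric in the two base points; uniqueness seen from
  \<open>S'\<close> gives injectivity, existence from there gives surjectivity.\<close>

lemma bij_betw_of_unique_partner:
  assumes "\<And>u. u \<in> S \<Longrightarrow> \<exists>!v. v \<in> S' \<and> R u v" "\<And>v. v \<in> S' \<Longrightarrow> \<exists>!u. u \<in> S \<and> R u v"
  shows "\<exists>\<phi>. bij_betw \<phi> S S' \<and> (\<forall>u\<in>S. R u (\<phi> u))"
proof -
  have "\<forall>u\<in>S. \<exists>v. v \<in> S' \<and> R u v" using assms(1) by blast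
  from bchoice[OF this] obtain \<phi> where \<phi>: "\<And>u. u \<in> S \<Longrightarrow> \<phi> u \<in> S' \<and> R u (\<phi> u)" by blast
  have "inj_on \<phi> S"
  proof (rule inj_onI)
    fix u u' assume "u \<in> S" "u' \<in> S" "\<phi> u = \<phi> u'"
    then show "u = u'" using \<phi>[of u] \<phi>[of u'] assms(2)[of "\<phi> u"] by auto
  qed
  moreover have "\<phi> ` S = S'"
  proof (intro equalityI subsetI)
    fix v assume v: "v \<in> S'"
    then obtain u where u: "u \<in> S" "R u v" using assms(2) by blast
    then have "\<phi> u = v" using \<phi>[OF u(1)] assms(1)[OF u(1)] v by blast
    with u(1) show "v \<in> \<phi> ` S" by blast
  qed (use \<phi> in blast)
  ultimately show ?thesis using \<phi> by (auto simp: bij_betw_def)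
qed

section \<open>Case 1: logarithmic moduli and expanding maps\<close>

lemma omega_log_nonneg: "omega_log t0 \<alpha> \<beta> t \<ge> 0"
  by (simp add: omega_log_def)

text \<open>Exponential contraction adds a multiple of k to the logarithm:
  \<open>- ln (l ^ k * d)\<close> is \<open>- ln d\<close> plus k times \<open>- ln l\<close>. This
  is why \<open>1 - ln d\<close> is the weight in this case.\<close>

lemma omega_log_0_le:
  assumes "t0 > 1" "\<beta> > 0" "0 < l" "l < 1"
  shows "\<exists>B>0. \<forall>k d e. 0 < d \<longrightarrow> d \<le> 1 \<longrightarrow> 0 \<le> e \<longrightarrow> e \<le> l ^ k * d \<longrightarrow>
    omega_log t0 0 \<beta> e \<le> B * (1 - ln d + real k) powr (- \<beta>)"
proof -
  \<comment> \<open>The smallest of the coefficients of \<open>- ln d\<close>, 1 and k in the lower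
    bound for \<open>ln t0 - ln e\<close>, which allows a termwise comparison.\<close>
  define \<kappa> where "\<kappa> = min 1 (min (ln t0) (- ln l))"
  have \<kappa>: "\<kappa> > 0" "\<kappa> \<le> 1" "\<kappa> \<le> ln t0" "\<kappa> \<le> - ln l"
    using assms by (auto simp: \<kappa>_def ln_less_zero)
  have "omega_log t0 0 \<beta> e \<le> \<kappa> powr (- \<beta>) * (1 - ln d + real k) powr (- \<beta>)"
    if d: "0 < d" "d \<le> 1" and e: "0 \<le> e" "e \<le> l ^ k * d" for k d e
  proof (cases "e = 0")
    case False
    have ld: "- ln d \<ge> 0" using d by simp
    have "ln e \<le> ln (l ^ k * d)" using e d False by simp
    also have "\<dots> = real k * ln l + ln d" using assms d by (simp add: ln_mult ln_realpow)
    finally have "ln e \<le> real k * ln l + ln d" .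
    moreover have "\<kappa> * real k \<le> - ln l * real k"
      using \<kappa> by (intro mult_right_mono) auto
    moreover have "\<kappa> * - ln d \<le> 1 * - ln d"
      by (intro mult_right_mono \<kappa>(2) ld)
    ultimately have "\<kappa> * (1 - ln d + real k) \<le> ln t0 - ln e"
      using \<kappa>(3) by (simp add: algebra_simps)
    moreover have "0 < \<kappa> * (1 - ln d + real k)"
      using \<kappa>(1) ld by (intro mult_pos_pos) auto
    ultimately have "(ln t0 - ln e) powr (- \<beta>) \<le> (\<kappa> * (1 - ln d + real k)) powr (- \<beta>)"
      using assms(2) by (intro powr_mono2') auto
    also have "\<dots> = \<kappa> powr (- \<beta>) * (1 - ln d + real k) powr (- \<beta>)"
      by (rule powr_mult)
    finally show ?thesis using False e by (simp add: omega_log_def)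
  qed (simp add: omega_log_def)
  moreover have "\<kappa> powr (- \<beta>) > 0" using \<kappa>(1) by simp
  ultimately show ?thesis by blast
qed

lemma omega_log_0_at_0:
  assumes "\<beta> > 0"
  shows "(omega_log t0 0 \<beta> \<longlongrightarrow> 0) (at_right 0)"
proof -
  have "LIM t at_right 0. - ln (t :: real) :> at_top"
    using filterlim_compose[OF filterlim_uminus_at_top_at_bot ln_at_0] by simp
  from filterlim_tendsto_add_at_top[OF tendsto_const this, of "ln t0"]
  have "LIM t at_right 0. ln t0 - ln t :> at_top" by simp
  then have "((\<lambda>t. (ln t0 - ln t) powr (- \<beta>)) \<longlongrightarrow> 0) (at_right 0)"
    using assms by (intro tendsto_neg_powr) auto
  then show ?thesis
    by (rule Lim_transform_eventually)
       (auto simp: omega_log_def eventually_at_filter)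
qed

text \<open>Here partners are determined step by step within \<open>l * r\<close>, so a bound on the
  distance alone is a sufficient matching relation.\<close>

lemma ruelle_expanding_contracting:
  fixes T :: "'a::metric_space \<Rightarrow> 'a"
  assumes cpt: "compact (UNIV :: 'a set)" and dist1: "\<And>x y :: 'a. dist x y \<le> 1"
    and mix: "topologically_mixing T" and norm: "ruelle_operator T a (\<lambda>_. 1) = (\<lambda>_. 1)"
    and T: "ruelle_expanding T" and a: "is_holder (omega_log t0 0 (\<gamma> + 1)) a"
    and t: "t0 > 1" "t1 > 1" and \<gamma>: "\<gamma> > 0"
  shows "\<exists>c r A B. contracting_operator T a (\<lambda>t. 1 - ln t) (omega_log t1 0 \<gamma>) c \<gamma> r A B"
proof -
  obtain l r where l: "0 < l" "l < 1" and r: "r > 0"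
    and ex: "\<And>x y x'. dist x y < r \<Longrightarrow> T x' = x \<Longrightarrow> \<exists>!y'. T y' = y \<and> dist x' y' < l * r"
    and le: "\<And>x y x' y'. dist x y < r \<Longrightarrow> T x' = x \<Longrightarrow> T y' = y \<Longrightarrow> dist x' y' < l * r \<Longrightarrow>
      dist x' y' \<le> l * dist x y"
    using T unfolding ruelle_expanding_def by blast
  obtain Ca where Ca: "holder_bound (omega_log t0 0 (\<gamma> + 1)) a Ca"
    using a by (auto simp: is_holder_def)
  have Ca0: "Ca \<ge> 0" by (rule holder_bound_nonneg[OF Ca])
  obtain B0 where B0: "B0 > 0" and B0_le: "\<And>k d e. 0 < d \<Longrightarrow> d \<le> 1 \<Longrightarrow> 0 \<le> e \<Longrightarrow> e \<le> l ^ k * d \<Longrightarrow>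
      omega_log t0 0 (\<gamma> + 1) e \<le> B0 * (1 - ln d + real k) powr (- (\<gamma> + 1))"
    using omega_log_0_le[of t0 "\<gamma> + 1" l] t \<gamma> l by auto
  obtain B1 where B1: "B1 > 0" and B1_le: "\<And>k d e. 0 < d \<Longrightarrow> d \<le> 1 \<Longrightarrow> 0 \<le> e \<Longrightarrow> e \<le> l ^ k * d \<Longrightarrow>
      omega_log t1 0 \<gamma> e \<le> B1 * (1 - ln d + real k) powr (- \<gamma>)"
    using omega_log_0_le[of t1 \<gamma> l] t \<gamma> l by auto
  define B where "B = B1 + Ca * B0"
  have B: "B > 0" "B1 \<le> B" "Ca * B0 \<le> B"
    using B0 B1 Ca0 by (auto simp: B_def add_pos_nonneg)
  have "contracting_operator T a (\<lambda>t. 1 - ln t) (omega_log t1 0 \<gamma>) (\<lambda>k. l ^ k) \<gamma> r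
    (Ca * B0 - a undefined) B"
  proof (unfold_locales)
    fix x
    have "\<bar>a x - a undefined\<bar> \<le> Ca * omega_log t0 0 (\<gamma> + 1) (dist x undefined)"
      by (rule holder_boundD[OF Ca])
    also have "\<dots> \<le> Ca * B0"
      using B0_le[of 1 "dist x undefined" 0] dist1 Ca0 by (intro mult_left_mono) auto
    finally show "- (Ca * B0 - a undefined) \<le> a x" by linarith
  next
    fix t :: real assume "0 \<le> t" "t \<le> 1"
    then show "omega_log t1 0 \<gamma> t \<le> B" using B1_le[of 1 t 0] B by simp
  next
    have "LIM t at_right 0. - ln (t :: real) :> at_top"
      using filterlim_compose[OF filterlim_uminus_at_top_at_bot ln_at_0] by simp
    from filterlim_tendsto_add_at_top[OF tendsto_const this, of 1]
    show "LIM t at_right 0. 1 - ln (t :: real) :> at_top" by simp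
  next
    show "(omega_log t1 0 \<gamma> \<longlongrightarrow> 0) (at_right 0)" by (rule omega_log_0_at_0[OF \<gamma>])
  next
    fix x y :: 'a assume xy: "x \<noteq> y" "dist x y < r"
    define d where "d = dist x y"
    have d: "0 < d" "d \<le> 1" using xy dist1 by (auto simp: d_def)
    define P where "P k z w \<longleftrightarrow> dist z w \<le> l ^ k * d" for k :: nat and z w :: 'a
    have "dist z w \<le> l ^ k \<and> omega_log t1 0 \<gamma> (dist z w) \<le> B * (1 - ln d + real k) powr (- \<gamma>) \<and>
        \<bar>a z - a w\<bar> \<le> B * (1 - ln d + real k) powr (- \<gamma> - 1) \<and>
        (\<exists>\<phi>. bij_betw \<phi> {u. T u = z} {u. T u = w} \<and> (\<forall>u. T u = z \<longrightarrow> P (Suc k) u (\<phi> u)))"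
      if "P k z w" for k z w
    proof (intro conjI)
      have zw: "dist z w \<le> l ^ k * d" using that by (simp add: P_def)
      also have "\<dots> \<le> l ^ k * 1" using d l by (intro mult_left_mono) auto
      finally show "dist z w \<le> l ^ k" by simp
      have "omega_log t1 0 \<gamma> (dist z w) \<le> B1 * (1 - ln d + real k) powr (- \<gamma>)"
        using d zw by (intro B1_le) auto
      also have "\<dots> \<le> B * (1 - ln d + real k) powr (- \<gamma>)"
        using B by (intro mult_right_mono) auto
      finally show "omega_log t1 0 \<gamma> (dist z w) \<le> B * (1 - ln d + real k) powr (- \<gamma>)" .
      have "\<bar>a z - a w\<bar> \<le> Ca * omega_log t0 0 (\<gamma> + 1) (dist z w)" by (rule holder_boundD[OF Ca])
      also have "\<dots> \<le> Ca * (B0 * (1 - ln d + real k) powr (- (\<gamma> + 1)))"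
        using d zw Ca0 by (intro mult_left_mono B0_le) auto
      also have "\<dots> = Ca * B0 * (1 - ln d + real k) powr (- \<gamma> - 1)" by simp
      also have "\<dots> \<le> B * (1 - ln d + real k) powr (- \<gamma> - 1)"
        using B by (intro mult_right_mono) auto
      finally show "\<bar>a z - a w\<bar> \<le> B * (1 - ln d + real k) powr (- \<gamma> - 1)" .
      \<comment> \<open>Matched points stay within the initial distance, so the expanding condition
        applies again at every depth.\<close>
      have "l ^ k * d \<le> 1 * d" using d l by (intro mult_right_mono) (auto simp: power_le_one)
      then have zwr: "dist z w < r" using zw xy(2) by (simp add: d_def)
      have "\<exists>\<phi>. bij_betw \<phi> {u. T u = z} {u. T u = w} \<and> (\<forall>u\<in>{u. T u = z}. dist u (\<phi> u) < l * r)"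
      proof (rule bij_betw_of_unique_partner)
        fix u assume "u \<in> {u. T u = z}"
        then show "\<exists>!v. v \<in> {u. T u = w} \<and> dist u v < l * r" using ex[OF zwr, of u] by simp
      next
        fix v assume "v \<in> {u. T u = w}"
        then show "\<exists>!u. u \<in> {u. T u = z} \<and> dist u v < l * r"
          using ex[of w z v] zwr by (simp add: dist_commute)
      qed
      then obtain \<phi> where \<phi>: "bij_betw \<phi> {u. T u = z} {u. T u = w}"
        "\<And>u. T u = z \<Longrightarrow> dist u (\<phi> u) < l * r" by auto
      have "P (Suc k) u (\<phi> u)" if u: "T u = z" for u
      proof -
        have "T (\<phi> u) = w" using bij_betw_apply[OF \<phi>(1), of u] u by simp
        from le[OF zwr u this \<phi>(2)[OF u]] have "dist u (\<phi> u) \<le> l * dist z w" .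
        also have "\<dots> \<le> l * (l ^ k * d)" using zw l by (intro mult_left_mono) auto
        finally show ?thesis by (simp add: P_def mult_ac)
      qed
      with \<phi>(1) show "\<exists>\<phi>. bij_betw \<phi> {u. T u = z} {u. T u = w} \<and> (\<forall>u. T u = z \<longrightarrow> P (Suc k) u (\<phi> u))"
        by blast
    qed
    moreover have "P 0 x y" by (simp add: P_def d_def)
    ultimately show "\<exists>P. P (0::nat) x y \<and> (\<forall>k z w. P k z w \<longrightarrow> dist z w \<le> l ^ k \<and>
        omega_log t1 0 \<gamma> (dist z w) \<le> B * (1 - ln (dist x y) + real k) powr (- \<gamma>) \<and>
        \<bar>a z - a w\<bar> \<le> B * (1 - ln (dist x y) + real k) powr (- \<gamma> - 1) \<and>
        (\<exists>\<phi>. bij_betw \<phi> {u. T u = z} {u. T u = w} \<and> (\<forall>u. T u = z \<longrightarrow> P (Suc k) u (\<phi> u))))"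
      unfolding d_def[symmetric] by (intro exI[of _ P]) blast
  qed (use cpt dist1 mix norm \<gamma> r B l in \<open>auto simp: omega_log_def intro!: LIMSEQ_power_zero\<close>)
  then show ?thesis by blast
qed

section \<open>Case 2: expansive maps with polynomial contraction rate\<close>

text \<open>Expansiveness at length \<open>Suc k\<close> yields \<open>v\<close>. Dropping the first
  point of its orbit shifts the rates by one, so \<open>T v\<close> satisfies the conditions that
  single out \<open>w\<close> at length \<open>k\<close>, and uniqueness there identifies
  them.\<close>

lemma ruelle_expansive_unique_child:
  assumes T: "ruelle_expansive c r T" and xy: "dist x y < r"
    and k: "(T ^^ k) z = x" "(T ^^ k) w = y"
      "\<And>j. j \<le> k \<Longrightarrow> dist ((T ^^ j) z) ((T ^^ j) w) \<le> c (k - j) (dist x y)"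
    and u: "T u = z"
  shows "\<exists>!v. T v = w \<and> (\<forall>j\<le>Suc k. dist ((T ^^ j) u) ((T ^^ j) v) \<le> c (Suc k - j) (dist x y))"
proof -
  have unique: "\<exists>!y'. (T ^^ n) y' = y \<and> (\<forall>j\<le>n. dist ((T ^^ j) x') ((T ^^ j) y') \<le> c (n - j) (dist x y))"
    if "n \<ge> 1" "(T ^^ n) x' = x" for n x'
    using T xy that unfolding ruelle_expansive_def by blast
  have shift: "(T ^^ Suc n) v = (T ^^ n) (T v)" for n v by (simp add: funpow_swap1)
  have "(T ^^ Suc k) u = x" using k(1) u by (simp only: shift)
  from unique[OF _ this] obtain v where v: "(T ^^ Suc k) v = y"
    "\<And>j. j \<le> Suc k \<Longrightarrow> dist ((T ^^ j) u) ((T ^^ j) v) \<le> c (Suc k - j) (dist x y)"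
    and v_unique: "\<And>v'. (T ^^ Suc k) v' = y \<Longrightarrow>
      (\<forall>j\<le>Suc k. dist ((T ^^ j) u) ((T ^^ j) v') \<le> c (Suc k - j) (dist x y)) \<Longrightarrow> v' = v"
    by (auto elim!: ex1E)
  have "T v = w"
  proof (cases k)
    \<comment> \<open>Expansiveness speaks of lengths at least 1, but at length 0 both points equal
      \<open>y\<close>.\<close>
    case 0
    then show ?thesis using v(1) k(2) by simp
  next
    case (Suc k')
    have "(T ^^ k) (T v) = y" using v(1) by (simp only: shift)
    moreover have "dist ((T ^^ j) z) ((T ^^ j) (T v)) \<le> c (k - j) (dist x y)" if "j \<le> k" for j
      using v(2)[of "Suc j"] that by (simp only: shift u Suc_le_mono diff_Suc_Suc)
    ultimately show ?thesis
      using unique[of k z] k Suc by (metis le_numeral_extra(4) less_eq_Suc_le zero_less_Suc One_nat_def)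
  qed
  moreover have "v' = v"
    if "T v' = w" "\<forall>j\<le>Suc k. dist ((T ^^ j) u) ((T ^^ j) v') \<le> c (Suc k - j) (dist x y)" for v'
    using that k(2) by (intro v_unique) (simp_all only: shift)
  ultimately show ?thesis using v(2) by blast
qed

text \<open>The relation must carry the whole orbit segment down to \<open>x\<close> and
  \<open>y\<close>, since uniqueness of partners refers to all of it.\<close>

lemma ruelle_expansive_matching:
  assumes T: "ruelle_expansive c r T" and xy: "dist x y < r"
  defines "P \<equiv> \<lambda>k z w. (T ^^ k) z = x \<and> (T ^^ k) w = y \<and>
    (\<forall>j\<le>k. dist ((T ^^ j) z) ((T ^^ j) w) \<le> c (k - j) (dist x y))"
  assumes zw: "P k z w"
  shows "\<exists>\<phi>. bij_betw \<phi> {u. T u = z} {u. T u = w} \<and> (\<forall>u. T u = z \<longrightarrow> P (Suc k) u (\<phi> u))"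
proof -
  note k = zw[unfolded P_def]
  define R where "R u v \<longleftrightarrow> (\<forall>j\<le>Suc k. dist ((T ^^ j) u) ((T ^^ j) v) \<le> c (Suc k - j) (dist x y))" for u v
  have "\<exists>\<phi>. bij_betw \<phi> {u. T u = z} {u. T u = w} \<and> (\<forall>u\<in>{u. T u = z}. R u (\<phi> u))"
  proof (rule bij_betw_of_unique_partner)
    fix u assume "u \<in> {u. T u = z}"
    then show "\<exists>!v. v \<in> {u. T u = w} \<and> R u v"
      using ruelle_expansive_unique_child[OF T xy, of k z w u] k by (simp add: R_def)
  next
    fix v assume "v \<in> {u. T u = w}"
    then show "\<exists>!u. u \<in> {u. T u = z} \<and> R u v"
      using ruelle_expansive_unique_child[OF T, of y x k w z v] k xy
      by (simp add: R_def dist_commute)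
  qed
  then obtain \<phi> where \<phi>: "bij_betw \<phi> {u. T u = z} {u. T u = w}" "\<And>u. T u = z \<Longrightarrow> R u (\<phi> u)"
    by auto
  have "P (Suc k) u (\<phi> u)" if u: "T u = z" for u
  proof -
    have "T (\<phi> u) = w" using bij_betw_apply[OF \<phi>(1), of u] u by simp
    with u k \<phi>(2)[OF u] show ?thesis by (simp add: P_def R_def funpow_swap1)
  qed
  with \<phi>(1) show ?thesis by blast
qed

lemma omega_log_power_le:
  assumes "\<alpha> \<ge> 0" "0 \<le> e" "e \<le> D"
  shows "omega_log t0 \<alpha> 0 e \<le> D powr \<alpha>"
proof -
  have "omega_log t0 \<alpha> 0 e \<le> e powr \<alpha>" by (simp add: omega_log_def)
  also have "\<dots> \<le> D powr \<alpha>" using assms by (intro powr_mono2) auto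
  finally show ?thesis .
qed

text \<open>Matched points at depth k are within
  \<open>K * (\<sigma> + real k) powr (- \<beta>)\<close>. The power \<alpha> of this has exponent -
  \<gamma> - 1, as the potential needs, and the power \<alpha> - 1 / \<beta> has exponent -
  \<gamma>.\<close>

lemma ruelle_expansive_contracting:
  fixes T :: "'a::metric_space \<Rightarrow> 'a"
  assumes cpt: "compact (UNIV :: 'a set)" and dist1: "\<And>x y :: 'a. dist x y \<le> 1"
    and mix: "topologically_mixing T" and norm: "ruelle_operator T a (\<lambda>_. 1) = (\<lambda>_. 1)"
    and T: "ruelle_expansive (poly_rate K \<beta>) r T" and a: "is_holder (omega_log t0 \<alpha> 0) a"
    and \<beta>: "\<beta> > 1" and \<alpha>: "\<alpha> > 1 / \<beta>" and K: "K > 0"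
  shows "\<exists>c A B. contracting_operator T a (\<lambda>t. t powr (- 1 / \<beta>)) (omega_log t0 (\<alpha> - 1 / \<beta>) 0) c
    (\<alpha> * \<beta> - 1) r A B"
proof -
  interpret N: normalized_operator T a by unfold_locales (rule norm)
  define \<gamma> where "\<gamma> = \<alpha> * \<beta> - 1"
  define \<alpha>' where "\<alpha>' = \<alpha> - 1 / \<beta>"
  have \<gamma>: "\<gamma> > 0" using \<alpha> \<beta> by (simp add: \<gamma>_def field_simps)
  have \<alpha>': "\<alpha>' > 0" using \<alpha> by (simp add: \<alpha>'_def)
  have "1 / \<beta> > 0" using \<beta> by simp
  with \<alpha> have \<alpha>0: "\<alpha> > 0" by linarith
  have exps: "- \<beta> * \<alpha>' = - \<gamma>" "- \<beta> * \<alpha> = - \<gamma> - 1"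
    using \<beta> by (simp_all add: \<gamma>_def \<alpha>'_def field_simps)
  have r: "r > 0" using T by (simp add: ruelle_expansive_def)
  obtain Ca where Ca: "holder_bound (omega_log t0 \<alpha> 0) a Ca"
    using a by (auto simp: is_holder_def)
  have Ca0: "Ca \<ge> 0" by (rule holder_bound_nonneg[OF Ca])
  define B where "B = 1 + K powr \<alpha>' + Ca * K powr \<alpha>"
  have B: "B \<ge> 1" "K powr \<alpha>' \<le> B" "Ca * K powr \<alpha> \<le> B"
    using Ca0 mult_nonneg_nonneg[OF Ca0, of "K powr \<alpha>"] by (auto simp: B_def)
  have "contracting_operator T a (\<lambda>t. t powr (- 1 / \<beta>)) (omega_log t0 \<alpha>' 0)
    (\<lambda>k. K * (1 + real k) powr (- \<beta>)) \<gamma> r (Ca - a undefined) B"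
  proof (unfold_locales)
    fix x
    have "\<bar>a x - a undefined\<bar> \<le> Ca * omega_log t0 \<alpha> 0 (dist x undefined)"
      by (rule holder_boundD[OF Ca])
    also have "\<dots> \<le> Ca * 1"
      using omega_log_power_le[of \<alpha> "dist x undefined" 1] dist1 Ca0 \<alpha>0 by (intro mult_left_mono) auto
    finally show "- (Ca - a undefined) \<le> a x" by linarith
  next
    fix t :: real assume "0 \<le> t" "t \<le> 1"
    then show "omega_log t0 \<alpha>' 0 t \<le> B" using omega_log_power_le[of \<alpha>' t 1 t0] \<alpha>' B by simp
  next
    fix t :: real assume t: "0 < t" "t \<le> 1"
    have "1 powr (- 1 / \<beta>) \<le> t powr (- 1 / \<beta>)" using t \<beta> by (intro powr_mono2') auto
    then show "1 \<le> t powr (- 1 / \<beta>)" by simp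
  next
    fix t u :: real assume "0 < t" "t \<le> u"
    then show "u powr (- 1 / \<beta>) \<le> t powr (- 1 / \<beta>)" using \<beta> by (intro powr_mono2') auto
  next
    have "LIM t at_right 0. (1 / \<beta>) * - ln t :> at_top"
      using \<beta> filterlim_compose[OF filterlim_uminus_at_top_at_bot ln_at_0]
      by (intro filterlim_tendsto_pos_mult_at_top[OF tendsto_const]) auto
    from filterlim_compose[OF exp_at_top this]
    show "LIM t at_right 0. t powr (- 1 / \<beta>) :> at_top"
      by (rule filterlim_mono_eventually) (auto simp: powr_def eventually_at_filter)
  next
    have "(\<lambda>k. (1 + real k) powr (- \<beta>)) \<longlonglongrightarrow> 0"
      using \<beta> by (intro tendsto_neg_powr filterlim_tendsto_add_at_top[OF tendsto_const filterlim_real_sequentially]) auto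
    from tendsto_mult_right_zero[OF this]
    show "(\<lambda>k. K * (1 + real k) powr (- \<beta>)) \<longlonglongrightarrow> 0" .
  next
    have lim: "((\<lambda>t. t powr \<alpha>') \<longlongrightarrow> 0) (at_right 0)"
      using \<alpha>' by (intro tendsto_zero_powrI[where b = \<alpha>'] tendsto_intros) (auto simp: eventually_at_filter)
    show "(omega_log t0 \<alpha>' 0 \<longlongrightarrow> 0) (at_right 0)"
    proof (rule tendsto_sandwich[OF _ _ tendsto_const lim])
      show "\<forall>\<^sub>F t in at_right 0. omega_log t0 \<alpha>' 0 t \<le> t powr \<alpha>'"
        by (simp add: omega_log_def)
    qed (simp add: omega_log_nonneg)
  next
    fix x y :: 'a assume xy: "x \<noteq> y" "dist x y < r"
    define d where "d = dist x y"
    define \<sigma> where "\<sigma> = d powr (- 1 / \<beta>)"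
    have d: "0 < d" "d \<le> 1" using xy dist1 by (auto simp: d_def)
    have \<sigma>: "\<sigma> \<ge> 1"
    proof -
      have "1 powr (- 1 / \<beta>) \<le> d powr (- 1 / \<beta>)" using d \<beta> by (intro powr_mono2') auto
      then show ?thesis by (simp add: \<sigma>_def)
    qed
    have rate: "poly_rate K \<beta> k d = K * (\<sigma> + real k) powr (- \<beta>)" for k
      using d by (simp add: poly_rate_def \<sigma>_def)
    define P where "P k z w \<longleftrightarrow> (T ^^ k) z = x \<and> (T ^^ k) w = y \<and>
      (\<forall>j\<le>k. dist ((T ^^ j) z) ((T ^^ j) w) \<le> poly_rate K \<beta> (k - j) (dist x y))" for k z w
    have "dist z w \<le> K * (1 + real k) powr (- \<beta>) \<and>
        omega_log t0 \<alpha>' 0 (dist z w) \<le> B * (\<sigma> + real k) powr (- \<gamma>) \<and>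
        \<bar>a z - a w\<bar> \<le> B * (\<sigma> + real k) powr (- \<gamma> - 1) \<and>
        (\<exists>\<phi>. bij_betw \<phi> {u. T u = z} {u. T u = w} \<and> (\<forall>u. T u = z \<longrightarrow> P (Suc k) u (\<phi> u)))"
      if zw: "P k z w" for k z w
    proof (intro conjI)
      have "\<forall>j\<le>k. dist ((T ^^ j) z) ((T ^^ j) w) \<le> poly_rate K \<beta> (k - j) (dist x y)"
        using zw by (simp add: P_def)
      from this[rule_format, of 0]
      have le: "dist z w \<le> K * (\<sigma> + real k) powr (- \<beta>)"
        by (simp add: rate d_def[symmetric])
      also have "\<dots> \<le> K * (1 + real k) powr (- \<beta>)"
        using \<sigma> \<beta> K by (intro mult_left_mono powr_mono2') auto
      finally show "dist z w \<le> K * (1 + real k) powr (- \<beta>)" .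
      have pow: "(K * (\<sigma> + real k) powr (- \<beta>)) powr q = K powr q * (\<sigma> + real k) powr (- \<beta> * q)" for q
        using K \<sigma> by (simp add: powr_mult powr_powr)
      have "omega_log t0 \<alpha>' 0 (dist z w) \<le> K powr \<alpha>' * (\<sigma> + real k) powr (- \<gamma>)"
        using omega_log_power_le[of \<alpha>' "dist z w" _ t0, OF _ _ le] \<alpha>' by (simp only: pow exps) simp
      also have "\<dots> \<le> B * (\<sigma> + real k) powr (- \<gamma>)"
        using B by (intro mult_right_mono) auto
      finally show "omega_log t0 \<alpha>' 0 (dist z w) \<le> B * (\<sigma> + real k) powr (- \<gamma>)" .
      have "\<bar>a z - a w\<bar> \<le> Ca * omega_log t0 \<alpha> 0 (dist z w)" by (rule holder_boundD[OF Ca])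
      also have "\<dots> \<le> Ca * (K powr \<alpha> * (\<sigma> + real k) powr (- \<gamma> - 1))"
        using omega_log_power_le[of \<alpha> "dist z w" _ t0, OF _ _ le] \<alpha>0 Ca0
        by (intro mult_left_mono) (simp only: pow exps, simp_all)
      also have "\<dots> = Ca * K powr \<alpha> * (\<sigma> + real k) powr (- \<gamma> - 1)" by simp
      also have "\<dots> \<le> B * (\<sigma> + real k) powr (- \<gamma> - 1)"
        using B by (intro mult_right_mono) auto
      finally show "\<bar>a z - a w\<bar> \<le> B * (\<sigma> + real k) powr (- \<gamma> - 1)" .
      show "\<exists>\<phi>. bij_betw \<phi> {u. T u = z} {u. T u = w} \<and> (\<forall>u. T u = z \<longrightarrow> P (Suc k) u (\<phi> u))"
        using ruelle_expansive_matching[OF T xy(2), of k z w] zw unfolding P_def by blast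
    qed
    \<comment> \<open>Not automatic: it says that \<open>dist x y\<close> is at most the rate at
      index 0. This is the last of the inequalities for orbits of length 1, read off at a preimage
      of \<open>x\<close>.\<close>
    moreover have "P 0 x y"
    proof -
      obtain x' where x': "T x' = x" using N.surj by blast
      then have "(T ^^ 1) x' = x" by simp
      with T xy(2) have "\<exists>!y'. (T ^^ 1) y' = y \<and>
          (\<forall>k\<le>1. dist ((T ^^ k) x') ((T ^^ k) y') \<le> poly_rate K \<beta> (1 - k) (dist x y))"
        unfolding ruelle_expansive_def by blast
      then obtain y' where y': "(T ^^ 1) y' = y"
        "\<And>k. k \<le> 1 \<Longrightarrow> dist ((T ^^ k) x') ((T ^^ k) y') \<le> poly_rate K \<beta> (1 - k) (dist x y)"
        by blast
      from y'(2)[of 1] y'(1) have "dist x y \<le> poly_rate K \<beta> 0 (dist x y)"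
        using x' by simp
      then show ?thesis by (simp add: P_def)
    qed
    ultimately show "\<exists>P. P (0::nat) x y \<and> (\<forall>k z w. P k z w \<longrightarrow>
        dist z w \<le> K * (1 + real k) powr (- \<beta>) \<and>
        omega_log t0 \<alpha>' 0 (dist z w) \<le> B * (dist x y powr (- 1 / \<beta>) + real k) powr (- \<gamma>) \<and>
        \<bar>a z - a w\<bar> \<le> B * (dist x y powr (- 1 / \<beta>) + real k) powr (- \<gamma> - 1) \<and>
        (\<exists>\<phi>. bij_betw \<phi> {u. T u = z} {u. T u = w} \<and> (\<forall>u. T u = z \<longrightarrow> P (Suc k) u (\<phi> u))))"
      unfolding d_def[symmetric] \<sigma>_def[symmetric] by (intro exI[of _ P]) blast
  qed (use cpt dist1 mix \<gamma> r B in \<open>auto simp: omega_log_def\<close>)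
  then show ?thesis unfolding \<gamma>_def \<alpha>'_def by blast
qed

theorem theorem1p3:
  fixes T :: "'a::metric_space \<Rightarrow> 'a"
    and a :: "'a \<Rightarrow> real"
    and \<gamma> :: real
    and \<omega>d :: "real \<Rightarrow> real"
    and \<omega> :: "nat \<Rightarrow> real \<Rightarrow> real"
  assumes "compact (UNIV :: 'a set)"
    and "diameter (UNIV :: 'a set) = 1"
    and "\<And>n. local_homeomorphism (T ^^ n)"
    and "topologically_mixing T"
    and "ruelle_operator T a (\<lambda>_. 1) = (\<lambda>_. 1)"
    and "case_one T a \<gamma> \<omega>d \<omega> \<or> case_two T a \<gamma> \<omega>d \<omega>"
  shows "(\<gamma> > 0 \<longrightarrow>
           (\<exists>(\<mu> :: 'a measure) C. prob_space \<mu> \<and> sets \<mu> = sets borel \<and> C > 0 \<and>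
              (\<forall>f n. is_holder \<omega>d f \<longrightarrow> n \<ge> 1 \<longrightarrow>
                 (let g = (\<lambda>x. (ruelle_operator T a ^^ n) f x - integral\<^sup>L \<mu> f) in
                    bounded (range g) \<and>
                    sup_norm g \<le> C * holder_const \<omega>d f * real n powr (- \<gamma>))))) \<and>
         (\<gamma> > 1 \<longrightarrow>
           (\<exists>(\<mu> :: 'a measure) C. prob_space \<mu> \<and> sets \<mu> = sets borel \<and> C > 0 \<and>
              (\<forall>f n. is_holder \<omega>d f \<longrightarrow> n \<ge> 1 \<longrightarrow>
                 (let g = (\<lambda>x. (ruelle_operator T a ^^ n) f x - integral\<^sup>L \<mu> f) in
                    bounded (range g) \<and> is_holder (\<omega> n) g \<and>
                    holder_norm (\<omega> n) g \<le> C * holder_const \<omega>d f))))"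
proof -
  have dist1: "dist x y \<le> 1" for x y :: 'a
    using diameter_bounded_bound[OF compact_imp_bounded[OF assms(1)], of x y] assms(2) by simp
  have "\<exists>s c r A B. contracting_operator T a s \<omega>d c \<gamma> r A B \<and> (\<forall>t. \<omega>d t \<ge> 0) \<and> (\<forall>n. \<omega> n 0 = 0) \<and>
      (\<forall>n t. n \<ge> 1 \<longrightarrow> 0 < t \<longrightarrow> t \<le> 1 \<longrightarrow> (s t + real n) powr (- \<gamma>) \<le> \<omega> n t)"
    using assms(6)
  proof
    assume "case_one T a \<gamma> \<omega>d \<omega>"
    then obtain \<beta> t0 t1 where *: "\<beta> > 1" "t0 > 1" "t1 > 1" "ruelle_expanding T"
      "is_holder (omega_log t0 0 \<beta>) a" "\<gamma> = \<beta> - 1" "\<omega>d = omega_log t1 0 (\<beta> - 1)"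
      "\<omega> = (\<lambda>n t. if t = 0 then 0 else (\<bar>ln t\<bar> + real n) powr (- \<gamma>))"
      unfolding case_one_def admissible_t0_def by blast
    have "\<exists>c r A B. contracting_operator T a (\<lambda>t. 1 - ln t) (omega_log t1 0 \<gamma>) c \<gamma> r A B"
      by (rule ruelle_expanding_contracting[OF assms(1) dist1 assms(4,5) *(4) _ *(2,3)]) (use * in auto)
    \<comment> \<open>The weight carries an extra 1 to be at least 1 at distance 1. For
      \<open>n = 0\<close> and \<open>t = 1\<close> the right side would be
      \<open>0 powr (- \<gamma>) = 0\<close>, hence the restriction on n.\<close>
    moreover have "(1 - ln t + real n) powr (- \<gamma>) \<le> \<omega> n t" if "n \<ge> 1" "0 < t" "t \<le> 1" for n t
    proof -
      have "ln t \<le> 0" using that by simp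
      then have "(1 - ln t + real n) powr (- \<gamma>) \<le> (\<bar>ln t\<bar> + real n) powr (- \<gamma>)"
        using that(1) *(1,6) by (intro powr_mono2') linarith+
      then show ?thesis using that *(8) by simp
    qed
    ultimately show ?thesis
      using *(6-8) omega_log_nonneg by (intro exI[of _ "\<lambda>t. 1 - ln t"]) auto
  next
    assume "case_two T a \<gamma> \<omega>d \<omega>"
    then obtain \<alpha> \<beta> K r t0 where *: "\<beta> > 1" "\<alpha> > 1 / \<beta>" "K > 0" "ruelle_expansive (poly_rate K \<beta>) r T"
      "is_holder (omega_log t0 \<alpha> 0) a" "\<gamma> = \<alpha> * \<beta> - 1" "\<omega>d = omega_log t0 (\<alpha> - 1 / \<beta>) 0"
      "\<omega> = (\<lambda>n t. if t = 0 then 0 else (t powr (- 1 / \<beta>) + real n) powr (- \<gamma>))"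
      unfolding case_two_def by blast
    have "\<exists>c A B. contracting_operator T a (\<lambda>t. t powr (- 1 / \<beta>)) \<omega>d c \<gamma> r A B"
      unfolding *(6,7) by (rule ruelle_expansive_contracting[OF assms(1) dist1 assms(4,5) *(4,5,1,2,3)])
    then show ?thesis
      using *(7,8) omega_log_nonneg by (intro exI[of _ "\<lambda>t. t powr (- 1 / \<beta>)"]) auto
  qed
  then obtain s c r A B where con: "contracting_operator T a s \<omega>d c \<gamma> r A B"
    and \<omega>: "\<And>t. \<omega>d t \<ge> 0" "\<And>n. \<omega> n 0 = 0"
      "\<And>n t. n \<ge> 1 \<Longrightarrow> 0 < t \<Longrightarrow> t \<le> 1 \<Longrightarrow> (s t + real n) powr (- \<gamma>) \<le> \<omega> n t"
    by (elim exE conjE) blast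
  from contracting_operator.holder_norm_decay[OF con \<omega>] show ?thesis
    unfolding Let_def by blast
qed

end
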